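(* Let $p,q$ be primes with $3<p<q$. Then there are infinitely many metabelian $(p,q)$-groups $G$ for which there exists a compact Riemann surface $X$ of some genus $g\geq 2$ (depending on $G$) with $G\subseteq Aut(X)$ and $$|G|=\frac{2p}{p-3}(g-1).$$
   Context: $Aut(X)$ denotes the full group of conformal automorphisms of $X$. For primes $p<q$, a $(p,q)$-group is a finite group of order $p^mq^n$ with $m,n\geq 1$. *)

theory Defs
  imports "HOL-Analysis.Analysis" "HOL-Algebra.Bij" "HOL-Algebra.Generated_Groups"
    "HOL-Computational_Algebra.Primes"
begin

(* A Riemann surface is a topological space X together with an atlas A of complex charts.
   A chart is a pair (U, f) where only the values of f on U matter; the atlas need not be
   maximal.  Second countability is not required: it is automatic for compact surfaces.
   Every Riemann surface has the cardinality of the continuum, so up to isomorphism its points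
   may be taken from any fixed type 'a of that cardinality; the topology X is arbitrary and
   unrelated to a topology that 'a may carry as a type class instance. *)

definition complex_chart :: "'a topology \<Rightarrow> 'a set \<times> ('a \<Rightarrow> complex) \<Rightarrow> bool" where
  "complex_chart X = (\<lambda>(U, f). openin X U \<and> open (f ` U) \<and>
     homeomorphic_map (subtopology X U) (top_of_set (f ` U)) f)"

definition complex_atlas :: "'a topology \<Rightarrow> ('a set \<times> ('a \<Rightarrow> complex)) set \<Rightarrow> bool" where
  "complex_atlas X A \<longleftrightarrow>
     (\<forall>c\<in>A. complex_chart X c) \<and>
     (\<Union>(U, f)\<in>A. U) = topspace X \<and>
     (\<forall>(U, f)\<in>A. \<forall>(V, h)\<in>A. (h \<circ> inv_into U f) holomorphic_on f ` (U \<inter> V))"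

definition riemann_surface :: "'a topology \<Rightarrow> ('a set \<times> ('a \<Rightarrow> complex)) set \<Rightarrow> bool" where
  "riemann_surface X A \<longleftrightarrow>
     topspace X \<noteq> {} \<and> Hausdorff_space X \<and> connected_space X \<and> complex_atlas X A"

definition holomorphic_map ::
  "'a topology \<Rightarrow> ('a set \<times> ('a \<Rightarrow> complex)) set \<Rightarrow>
   'b topology \<Rightarrow> ('b set \<times> ('b \<Rightarrow> complex)) set \<Rightarrow> ('a \<Rightarrow> 'b) \<Rightarrow> bool" where
  "holomorphic_map X A Y B \<phi> \<longleftrightarrow>
     continuous_map X Y \<phi> \<and>
     (\<forall>(U, f)\<in>A. \<forall>(V, h)\<in>B.
        (h \<circ> \<phi> \<circ> inv_into U f) holomorphic_on f ` (U \<inter> \<phi> -` V))"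

(* Composition is inherited from BijGroup, so automorphisms are represented by extensional
   functions on topspace X. *)

definition Aut :: "'a topology \<Rightarrow> ('a set \<times> ('a \<Rightarrow> complex)) set \<Rightarrow> ('a \<Rightarrow> 'a) monoid" where
  "Aut X A = (BijGroup (topspace X))
     \<lparr>carrier := {\<phi> \<in> Bij (topspace X).
        holomorphic_map X A X A \<phi> \<and>
        holomorphic_map X A X A (inv_into (topspace X) \<phi>)}\<rparr>"

(* The genus of a compact Riemann surface: V - E + F = 2 - 2 g for a triangulation.  Every
   compact surface is triangulable (Rado) and V - E + F does not depend on the triangulation.
   Since every finite 2-dimensional simplicial complex has a rectilinear realization in R^5,
   simplicial complexes in R^5 give all triangulations. *)

definition has_genus :: "'a topology \<Rightarrow> nat \<Rightarrow> bool" where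
  "has_genus X g \<longleftrightarrow>
     (\<exists>C :: (real^5) set set.
        simplicial_complex C \<and> X homeomorphic_space top_of_set (\<Union>C) \<and>
        int (card {S \<in> C. 0 simplex S}) - int (card {S \<in> C. 1 simplex S})
          + int (card {S \<in> C. 2 simplex S}) = 2 - 2 * int g)"

definition pq_group :: "nat \<Rightarrow> nat \<Rightarrow> ('a, 'b) monoid_scheme \<Rightarrow> bool" where
  "pq_group p q G \<longleftrightarrow> group G \<and> finite (carrier G) \<and>
     (\<exists>m n. m \<ge> 1 \<and> n \<ge> 1 \<and> order G = p ^ m * q ^ n)"

definition metabelian :: "('a, 'b) monoid_scheme \<Rightarrow> bool" where
  "metabelian G \<longleftrightarrow> group G \<and> comm_group (G\<lparr>carrier := derived G (carrier G)\<rparr>)"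

end

theory Submission
  imports Defs "HOL-Algebra.Multiplicative_Group" "HOL-Algebra.Weak_Morphisms"
begin

text \<open>Let \<open>G\<close> be a finite group generated by two elements \<open>a\<close> and \<open>b\<close> such that \<open>a\<close>, \<open>b\<close> and their
  product have prime order \<open>p > 3\<close> and \<open>b\<close> is not a power of \<open>a\<close>.  Then \<open>G\<close> is a quotient of the
  triangle group with periods \<open>p\<close>, \<open>p\<close>, \<open>p\<close>, and the quotient of the hyperbolic plane by the kernel
  is a compact Riemann surface on which \<open>G\<close> acts.  It is tessellated by \<open>2 * order G\<close> triangles, with
  \<open>3 * order G / p\<close> vertices of degree \<open>2 * p\<close>, which gives the required relation between genus and
  order.

  The surface is built here from its combinatorics, without the hyperbolic plane.  Its vertices are the left
  cosets of the cyclic groups generated by \<open>a\<close>, \<open>b\<close> and the inverse of their product; since these groups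
  meet trivially, the triangles form a simplicial complex (locale \<open>triangle_group\<close>).  Placing the
  vertices on the moment curve realizes it as a polyhedron in five-dimensional space
  (\<open>exists_geometric_triangulation\<close>), and the genus is found by counting simplices
  (\<open>has_genus_polyhedron\<close>).

  The complex structure is that of the metric in which all triangles are flat and equilateral.  There is one
  chart for each vertex, defined on its open star.  At a vertex of degree \<open>d\<close> the triangles form a
  cone, and if \<open>u\<close> is the flat coordinate in which the vertex is 0 and a neighbour is 1, then the chart is
  \<open>u\<close> raised to \<open>6 / d\<close>, up to rotation.  Going to the neighbour replaces \<open>u\<close> by \<open>1 - u\<close>, so the
  changes of charts are holomorphic (\<open>wt_transition\<close>, \<open>riemann_surface_polyhedron\<close>), and
  automorphisms of the oriented triangulation act by rotations in the charts
  (\<open>pl_map_holomorphic\<close>).  Left multiplication by elements of \<open>G\<close> gives such automorphisms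
  (\<open>acts_on_riemann_surface\<close>).

  It remains to find suitable groups of unbounded order.  In the wreath product of the cyclic groups of
  orders \<open>q ^ n\<close> and \<open>p\<close>, two generators that act by the same shift and differ by an element of the
  base group of order \<open>q ^ n\<close> with coordinate sum 0 have the required properties.  The group that they
  generate is metabelian because the base group is abelian, and its order is \<open>p\<close> times a power of \<open>q\<close>
  that is divisible by \<open>q ^ n\<close> (\<open>exists_large_group\<close>).\<close>

section \<open>Conformal hat functions on a sector\<close>

text \<open>Around a vertex of degree \<open>d\<close> the flat cone of \<open>d\<close> equilateral triangles is flattened to a
  neighbourhood of 0 by the power map with exponent \<open>6 / d\<close>, each triangle becoming a sector of angle
  \<open>2 * pi / d\<close>.  In this picture, \<open>hat d w\<close> is the barycentric coordinate of \<open>w\<close> with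
  respect to the neighbour on the positive real axis.  In the two sectors at that axis it is the
  coefficient of 1 in the expansion of \<open>w\<close> raised to \<open>d / 6\<close> with respect to 1 and \<open>\<omega>\<close>
  above the axis, 1 and \<open>cnj \<omega>\<close> below it; elsewhere it is 0.  The
  use of \<open>arccos\<close> for the modulus of the argument makes continuity across the negative axis visible.\<close>

definition hat :: "nat \<Rightarrow> complex \<Rightarrow> real" where
  "hat d w = 2 / sqrt 3 * norm w powr (real d / 6) *
     sin (max 0 (pi / 3 - real d / 6 * arccos (Re w / norm w)))"

definition rot :: "nat \<Rightarrow> int \<Rightarrow> complex" where
  "rot d k = cis (2 * pi * of_int k / real d)"

abbreviation sixth_root :: complex ("\<omega>") where
  "\<omega> \<equiv> cis (pi / 3)"

lemma rot_add: "rot d (j + k) = rot d j * rot d k"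
  by (simp add: rot_def cis_mult add_divide_distrib distrib_left)

lemma rot_0 [simp]: "rot d 0 = 1"
  by (simp add: rot_def)

lemma norm_rot [simp]: "norm (rot d k) = 1"
  by (simp add: rot_def)

lemma rot_nonzero [simp]: "rot d k \<noteq> 0"
  using norm_rot[of d k] by (metis norm_zero zero_neq_one)

lemma rot_period: "d > 0 \<Longrightarrow> rot d (k + int d * n) = rot d k"
proof -
  assume "d > 0"
  then have "2 * pi * of_int (k + int d * n) / real d = 2 * pi * of_int k / real d + 2 * pi * of_int n"
    by (simp add: field_simps)
  then show ?thesis
    unfolding rot_def by (metis cis_mult cis_multiple_2pi Ints_of_int mult.right_neutral)
qed

lemma rcis_mult_rot: "rcis r \<theta> * rot d k = rcis r (\<theta> + 2 * pi * of_int k / real d)"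
  by (simp add: rot_def rcis_def cis_mult)

lemma hat_rcis:
  assumes "0 \<le> r" "\<bar>\<theta>\<bar> \<le> pi"
  shows "hat d (rcis r \<theta>) =
    2 / sqrt 3 * r powr (real d / 6) * sin (max 0 (pi / 3 - real d / 6 * \<bar>\<theta>\<bar>))"
proof (cases "r = 0")
  case False
  then have "Re (rcis r \<theta>) / norm (rcis r \<theta>) = cos \<theta>"
    using assms by simp
  then show ?thesis
    using assms by (simp add: hat_def arccos_cos_eq_abs)
qed (simp add: hat_def)

lemma hat_Arg:
  "hat d w = 2 / sqrt 3 * norm w powr (real d / 6) * sin (max 0 (pi / 3 - real d / 6 * \<bar>Arg w\<bar>))"
  using hat_rcis[of "norm w" "Arg w" d] Arg_bounded[of w] by (simp add: rcis_cmod_Arg abs_le_iff)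

lemma hat_0 [simp]: "hat d 0 = 0"
  by (simp add: hat_def)

lemma hat_cnj [simp]: "hat d (cnj w) = hat d w"
  by (simp add: hat_def)

lemma hat_nonneg [simp]: "0 \<le> hat d w"
proof -
  have "0 \<le> max 0 (pi / 3 - real d / 6 * \<bar>Arg w\<bar>)" "max 0 (pi / 3 - real d / 6 * \<bar>Arg w\<bar>) \<le> pi"
    using pi_gt_zero by (auto simp: max_def field_simps intro: add_increasing2)
  then have "0 \<le> sin (max 0 (pi / 3 - real d / 6 * \<bar>Arg w\<bar>))"
    using sin_ge_zero by blast
  then show ?thesis
    unfolding hat_Arg by simp
qed

lemma hat_pos_iff:
  assumes "d > 0"
  shows "0 < hat d w \<longleftrightarrow> w \<noteq> 0 \<and> \<bar>Arg w\<bar> < 2 * pi / real d"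
proof (cases "w = 0")
  case False
  show ?thesis
  proof (cases "\<bar>Arg w\<bar> < 2 * pi / real d")
    case True
    then have "0 < pi / 3 - real d / 6 * \<bar>Arg w\<bar>"
      using assms by (simp add: field_simps)
    moreover have "pi / 3 - real d / 6 * \<bar>Arg w\<bar> < pi"
    proof -
      have "0 \<le> real d / 6 * \<bar>Arg w\<bar>" by simp
      then show ?thesis using pi_gt_zero by linarith
    qed
    ultimately have "0 < sin (max 0 (pi / 3 - real d / 6 * \<bar>Arg w\<bar>))"
      by (simp add: sin_gt_zero)
    then show ?thesis
      unfolding hat_Arg using True False by simp
  next
    case F: False
    then have "pi / 3 - real d / 6 * \<bar>Arg w\<bar> \<le> 0"
      using assms by (simp add: field_simps)
    then show ?thesis
      unfolding hat_Arg using F by (simp add: max_absorb1)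
  qed
qed simp

lemma continuous_on_hat: 
  assumes "d > 0" shows "continuous_on UNIV (hat d)"
proof -
  have "isCont (hat d) w" for w
  proof (cases "w = 0")
    case True
    have bd: "norm (hat d z) \<le> 2 * norm z powr (real d / 6)" for z
    proof -
      have "sqrt 3 \<ge> 1" by simp
      then have "\<bar>2 / sqrt 3\<bar> \<le> 2" by (simp add: field_simps)
      moreover have "\<bar>sin x\<bar> \<le> 1" for x :: real by simp
      ultimately have "\<bar>2 / sqrt 3\<bar> * \<bar>sin x\<bar> \<le> 2 * 1" for x :: real
        by (intro mult_mono) auto
      note b = this
      have "norm (hat d z) = \<bar>2 / sqrt 3\<bar> * \<bar>sin (max 0 (pi / 3 - real d / 6 * arccos (Re z / norm z)))\<bar> * norm z powr (real d / 6)"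
        unfolding hat_def by (simp add: abs_mult)
      then show ?thesis
        using mult_right_mono[OF b, of "norm z powr (real d / 6)"] by simp
    qed
    have "((\<lambda>z::complex. 2 * norm z powr (real d / 6)) \<longlongrightarrow> 2 * norm (0::complex) powr (real d / 6)) (at 0)"
      using assms by (intro tendsto_intros) auto
    then have "((\<lambda>z::complex. 2 * norm z powr (real d / 6)) \<longlongrightarrow> 0) (at 0)"
      by simp
    then have "(hat d \<longlongrightarrow> 0) (at 0)"
      by (rule Lim_null_comparison[rotated]) (simp add: bd del: real_norm_def)
    then show ?thesis
      using True by (simp add: isCont_def)
  next
    case False
    have "isCont arccos' (Re w / norm w)" if "arccos' = (\<lambda>x. arccos (max (-1) (min 1 x)))" for arccos'
    proof -
      have "continuous_on UNIV (\<lambda>x. arccos (max (-1) (min 1 x)))"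
        by (intro continuous_on_arccos continuous_intros) auto
      then show ?thesis
        using that by (simp add: continuous_on_eq_continuous_at)
    qed
    note ac = this[OF refl]
    have "isCont (\<lambda>z. arccos (max (-1) (min 1 (Re z / norm z)))) w"
      by (rule isCont_o2[where f = "\<lambda>z. Re z / norm z" and g = "\<lambda>x. arccos (max (-1) (min 1 x))", OF _ ac])
        (use False in \<open>intro continuous_intros; simp\<close>)
    moreover have "arccos (max (-1) (min 1 (Re z / norm z))) = arccos (Re z / norm z)" for z :: complex
      using abs_Re_le_cmod[of z] 
      by (cases "z = 0") (auto simp: max_def min_def field_simps abs_le_iff)
    ultimately have "isCont (\<lambda>z. arccos (Re z / norm z)) w"
      by simp
    then show ?thesis
      unfolding hat_def using False assms by (intro continuous_intros) auto
  qed
  then show ?thesis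
    by (simp add: continuous_at_imp_continuous_on)
qed

lemma Arg_rot:
  fixes k :: int
  obtains n :: int where "Arg (w * rot d k) = Arg w + 2 * pi * k / real d + 2 * pi * n" | "w = 0"
proof (cases "w = 0")
  case False
  have "cis (Arg (w * rot d k)) = sgn (w * rot d k)"
    using False by (simp add: cis_Arg)
  also have "\<dots> = sgn w * rot d k"
    by (simp add: sgn_mult) (simp add: sgn_div_norm scaleR_conv_of_real)
  also have "\<dots> = cis (Arg w + 2 * pi * k / real d)"
    using False by (simp add: rot_def cis_mult flip: cis_Arg)
  finally have "cis (Arg (w * rot d k)) = cis (Arg w + 2 * pi * k / real d)" .
  then obtain n :: int where "Arg (w * rot d k) = Arg w + 2 * pi * k / real d + 2 * pi * n"
    by (metis sin_cos_eq_iff cis.sel)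
  then show ?thesis using that by blast
qed

text \<open>The support of a hat reaches out to the adjacent axes only, and the axes are \<open>2 * pi / d\<close>
  apart, so the hats of axes that are not adjacent have disjoint supports.\<close>

lemma hat_support:
  assumes "d \<ge> 3" "0 < hat d w" "0 < hat d (w * rot d (- k))"
  obtains n :: int where "\<bar>k - int d * n\<bar> \<le> 1"
proof -
  have w: "w \<noteq> 0" "\<bar>Arg w\<bar> < 2 * pi / real d" "\<bar>Arg (w * rot d (- k))\<bar> < 2 * pi / real d"
    using assms hat_pos_iff[of d] by auto
  obtain n :: int where n: "Arg (w * rot d (- k)) = Arg w + 2 * pi * of_int (- k) / real d + 2 * pi * n"
    using Arg_rot[of w d "- k"] w(1) by auto
  have "\<bar>2 * pi * of_int (- k) / real d + 2 * pi * n\<bar> < 2 * (2 * pi / real d)"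
    using n w by linarith
  moreover have "2 * pi * of_int (- k) / real d + 2 * pi * n = (2 * pi / real d) * of_int (int d * n - k)"
    using assms(1) by (simp add: field_simps)
  ultimately have "(2 * pi / real d) * \<bar>of_int (int d * n - k)\<bar> < (2 * pi / real d) * 2"
    using assms(1) by (simp add: abs_mult mult.commute)
  then have "\<bar>real_of_int (int d * n - k)\<bar> < 2"
    using assms(1) by (subst (asm) mult_less_cancel_left_pos) auto
  then have "\<bar>k - int d * n\<bar> \<le> 1" by linarith
  then show ?thesis using that by blast
qed

lemma exists_hat_pos:
  assumes "d \<ge> 3" "w \<noteq> 0"
  obtains k where "0 < hat d (w * rot d (- k))"
proof -
  \<comment> \<open>The sector of \<open>w\<close>, counted from the axis at its clockwise side.\<close>
  define k where "k = \<lfloor>Arg w * real d / (2 * pi)\<rfloor>"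
  have fl: "of_int k \<le> Arg w * real d / (2 * pi)" "Arg w * real d / (2 * pi) < of_int k + 1"
    unfolding k_def by linarith+
  define \<theta> where "\<theta> = Arg w - 2 * pi * of_int k / real d"
  have \<theta>: "0 \<le> \<theta>" "\<theta> < 2 * pi / real d"
  proof -
    have "2 * pi / real d * (Arg w * real d / (2 * pi)) = Arg w"
      using assms(1) by simp
    moreover have "0 < 2 * pi / real d" using assms(1) by simp
    ultimately show "0 \<le> \<theta>" "\<theta> < 2 * pi / real d"
      using mult_left_mono[OF fl(1), of "2 * pi / real d"] mult_strict_left_mono[OF fl(2), of "2 * pi / real d"]
      by (simp_all add: \<theta>_def distrib_left)
  qed
  have "w * rot d (- k) = rcis (norm w) \<theta>"
    using rcis_mult_rot[of "norm w" "Arg w" d "-k"] by (simp add: rcis_cmod_Arg \<theta>_def)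
  moreover have "2 * pi / real d \<le> pi"
    using assms(1) by (simp add: field_simps)
  ultimately have "Arg (w * rot d (- k)) = \<theta>"
    using \<theta> assms(2) Arg_rcis[of \<theta> "norm w"] by auto
  then have "0 < hat d (w * rot d (- k))"
    using hat_pos_iff[of d] assms \<theta> by auto
  then show ?thesis using that by blast
qed

text \<open>In a single sector the claim is the sine rule
  \<open>sin (pi / 3 - \<phi>) + sin \<phi> * \<omega> = sqrt 3 / 2 * cis \<phi>\<close>, which also explains the factor
  \<open>2 / sqrt 3\<close> in the definition.\<close>

lemma hat_sector_aux:
  assumes "d \<ge> 3" "0 < hat d u" "0 \<le> Arg u"
  shows "hat d (u * rot d 1) = 0"
    and "u powr of_real (real d / 6) = hat d u + hat d (u * rot d (- 1)) * \<omega>"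
proof -
  define r \<theta> \<beta> where "r = norm u" and "\<theta> = Arg u" and "\<beta> = 2 * pi / real d"
  have u: "u = rcis r \<theta>" "r > 0" "0 \<le> \<theta>" "\<theta> < \<beta>"
    using assms hat_pos_iff[of d u] by (auto simp: r_def \<theta>_def \<beta>_def rcis_cmod_Arg)
  have \<beta>: "3 * \<beta> \<le> 2 * pi" "real d / 6 * \<beta> = pi / 3" "0 < \<beta>"
    using assms(1) by (simp_all add: \<beta>_def field_simps)
  have rot1: "u * rot d 1 = rcis r (\<theta> + \<beta>)" "u * rot d (- 1) = rcis r (\<theta> - \<beta>)"
    unfolding u(1) rcis_mult_rot by (simp_all add: \<beta>_def)
  show "hat d (u * rot d 1) = 0"
  proof (cases "\<theta> + \<beta> \<le> pi")
    case True
    have "hat d (u * rot d 1) = 2 / sqrt 3 * r powr (real d / 6) * sin (max 0 (pi / 3 - real d / 6 * (\<theta> + \<beta>)))"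
      unfolding rot1 using hat_rcis[of r "\<theta> + \<beta>" d] u \<beta> True by simp
    moreover have "pi / 3 - real d / 6 * (\<theta> + \<beta>) \<le> 0"
      using u(3) \<beta>(2) by (simp add: distrib_left)
    ultimately show ?thesis by (simp add: max_absorb1)
  next
    case False
    \<comment> \<open>The angle has passed \<open>pi\<close>; as \<open>d \<ge> 3\<close>, its other representative is still too large.\<close>
    have e: "u * rot d 1 = rcis r (\<theta> + \<beta> - 2 * pi)"
      unfolding rot1 rcis_def
      by (metis cis_2pi cis_divide div_by_1)
    have "hat d (u * rot d 1) = 2 / sqrt 3 * r powr (real d / 6) * sin (max 0 (pi / 3 - real d / 6 * (2 * pi - \<theta> - \<beta>)))"
      unfolding e using hat_rcis[of r "\<theta> + \<beta> - 2 * pi" d] u \<beta> False by (simp add: abs_if diff_diff_eq)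
    moreover have "real d / 6 * \<beta> \<le> real d / 6 * (2 * pi - \<theta> - \<beta>)"
      using u \<beta> by (intro mult_left_mono) auto
    ultimately show ?thesis using \<beta>(2) by (simp add: max_absorb1)
  qed
  define \<phi> where "\<phi> = real d / 6 * \<theta>"
  have d6: "0 < real d / 6" using assms(1) by simp
  have \<phi>: "0 \<le> \<phi>" "\<phi> < pi / 3"
    using u(3) mult_strict_left_mono[OF u(4) d6] unfolding \<beta>(2) \<phi>_def by simp_all
  have h0: "hat d u = 2 / sqrt 3 * r powr (real d / 6) * sin (pi / 3 - \<phi>)"
    unfolding u(1) using hat_rcis[of r "\<theta>" d] u \<beta> \<phi> by (simp add: \<phi>_def)
  have "\<bar>\<theta> - \<beta>\<bar> = \<beta> - \<theta>"
    using u by simp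
  moreover have "real d / 6 * (\<beta> - \<theta>) = pi / 3 - \<phi>"
    using \<beta>(2) by (simp add: \<phi>_def right_diff_distrib)
  ultimately have "real d / 6 * \<bar>\<theta> - \<beta>\<bar> = pi / 3 - \<phi>"
    by (simp only:)
  then have "max 0 (pi / 3 - real d / 6 * \<bar>\<theta> - \<beta>\<bar>) = \<phi>"
    using \<phi> by linarith
  then have h1: "hat d (u * rot d (- 1)) = 2 / sqrt 3 * r powr (real d / 6) * sin \<phi>"
    unfolding rot1 using hat_rcis[of r "\<theta> - \<beta>" d] u \<beta> by simp
  have pw: "u powr of_real (real d / 6) = of_real (r powr (real d / 6)) * cis \<phi>"
  proof -
    have "u \<noteq> 0" using u by auto
    then have "u powr of_real (real d / 6) = exp (of_real (real d / 6) * Ln u)"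
      by (simp add: powr_def)
    also have "Ln u = of_real (ln r) + \<i> * of_real \<theta>"
      using \<open>u \<noteq> 0\<close> by (simp add: complex_eq_iff r_def \<theta>_def Arg_eq_Im_Ln)
    also have "exp (of_real (real d / 6) * (of_real (ln r) + \<i> * of_real \<theta>)) =
        exp (of_real (real d / 6 * ln r)) * exp (\<i> * of_real \<phi>)"
      by (simp add: \<phi>_def exp_add[symmetric] algebra_simps)
    also have "exp (complex_of_real (real d / 6 * ln r)) = of_real (r powr (real d / 6))"
      using u(2) by (subst exp_of_real) (simp add: powr_def)
    finally show ?thesis
      by (simp only: cis_conv_exp)
  qed
  have sq: "sqrt 3 * sqrt 3 = (3::real)" by simp
  have "sin (pi / 3 - \<phi>) = sqrt 3 / 2 * cos \<phi> - sin \<phi> / 2"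
    by (simp add: sin_diff sin_60 cos_60)
  note sd = this
  have "cis \<phi> = of_real (2 / sqrt 3 * sin (pi / 3 - \<phi>)) + of_real (2 / sqrt 3 * sin \<phi>) * \<omega>"
    unfolding sd by (simp add: complex_eq_iff sin_60 cos_60 field_simps sq)
  then show "u powr of_real (real d / 6) = hat d u + hat d (u * rot d (- 1)) * \<omega>"
    unfolding pw h0 h1 by (simp add: algebra_simps)
qed

lemma cnj_rot: "cnj (rot d k) = rot d (- k)"
  by (simp add: rot_def cis_cnj)

lemma Arg_cnj_neg:
  assumes "Arg u < 0"
  shows "u \<notin> \<real>" "Arg (cnj u) = - Arg u" "u \<notin> \<real>\<^sub>\<le>\<^sub>0"
proof -
  show *: "u \<notin> \<real>"
    using assms pi_gt_zero by (auto elim!: Reals_cases simp: Arg_of_real split: if_splits)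
  then show "Arg (cnj u) = - Arg u" by (simp add: Arg_cnj)
  show "u \<notin> \<real>\<^sub>\<le>\<^sub>0" using * by auto
qed

text \<open>The hats recover the flat coordinate of a point: this identity yields injectivity of the charts
  and the formula for the change of charts.  The term for the sector not containing \<open>u\<close> vanishes, so
  that the two sectors at the real axis need not be distinguished.\<close>

lemma hat_sector:
  assumes "d \<ge> 3" "0 < hat d u"
  shows "u powr of_real (real d / 6) = hat d u + hat d (u * rot d (- 1)) * \<omega> + hat d (u * rot d 1) * cnj \<omega>"
proof (cases "0 \<le> Arg u")
  case True
  then show ?thesis using hat_sector_aux[OF assms True] by simp
next
  case False
  have "0 \<le> Arg (cnj u)" 
    using False Arg_cnj_neg[of u] by auto
  moreover have "cnj (cnj u powr of_real (real d / 6)) = u powr of_real (real d / 6)"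
    using False Arg_cnj_neg[of u] by (subst cnj_powr) (auto simp: complex_is_Real_iff)
  ultimately have "u powr of_real (real d / 6) = cnj (hat d (cnj u) + hat d (cnj u * rot d (- 1)) * \<omega>)"
    "hat d (cnj u * rot d 1) = 0"
    using hat_sector_aux[of d "cnj u"] assms by simp_all
  moreover have "hat d (cnj u * rot d k) = hat d (u * rot d (- k))" for k
    using hat_cnj[of d "u * rot d (- k)"] by (simp add: cnj_rot)
  ultimately show ?thesis by simp
qed

lemma hat_neighbours_exclusive:
  assumes "d \<ge> 3" "0 < hat d u"
  shows "hat d (u * rot d (- 1)) = 0 \<or> hat d (u * rot d 1) = 0"
proof (cases "0 \<le> Arg u")
  case True
  then show ?thesis using hat_sector_aux[OF assms True] by simp
next
  case False
  then have "0 \<le> Arg (cnj u)" 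
    using Arg_cnj_neg[of u] by auto
  moreover have "hat d (cnj u * rot d 1) = hat d (u * rot d (- 1))"
    using hat_cnj[of d "u * rot d (- 1)"] by (simp add: cnj_rot)
  ultimately show ?thesis using hat_sector_aux(1)[of d "cnj u"] assms by simp
qed

text \<open>On the support of the hat the argument of \<open>u\<close> is below \<open>2 * pi / d\<close>, so its image
  under the power map has argument below \<open>pi / 3\<close>, and no branch cut is met on either side.\<close>

lemma powr_hat_inverse:
  assumes "d \<ge> 3" "0 < hat d u"
  shows "(u powr of_real (real d / 6)) powr of_real (6 / real d) = u"
    and "u powr of_real (real d / 6) \<notin> \<real>\<^sub>\<le>\<^sub>0" and "u \<notin> \<real>\<^sub>\<le>\<^sub>0"
proof -
  have u: "u \<noteq> 0" "\<bar>Im (Ln u)\<bar> < 2 * pi / real d"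
    using assms hat_pos_iff[of d u] by (auto simp: Arg_eq_Im_Ln)
  have "2 * pi / real d < pi" using assms(1) by (simp add: field_simps)
  then show "u \<notin> \<real>\<^sub>\<le>\<^sub>0"
    using u Im_Ln_eq_pi[OF u(1)] complex_eq_iff[of u 0] by (auto simp: complex_nonpos_Reals_iff)
  define a where "a = real d / 6"
  have a: "a > 0" using assms(1) by (simp add: a_def)
  have im: "\<bar>a * Im (Ln u)\<bar> < pi / 3"
    using mult_strict_left_mono[OF u(2) a] assms(1) a by (simp add: a_def abs_mult)
  have ln: "Ln (u powr of_real a) = of_real a * Ln u"
    using u im pi_gt_zero by (simp add: powr_def)
  have "u powr of_real a \<noteq> 0" using u by simp
  then have "(u powr of_real a) powr of_real (6 / real d) = exp (of_real (6 / real d * a) * Ln u)"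
    unfolding powr_def[of "u powr of_real a"] ln by (simp add: mult.assoc)
  also have "6 / real d * a = 1"
    using assms(1) by (simp add: a_def)
  finally show "(u powr of_real (real d / 6)) powr of_real (6 / real d) = u"
    using u by (simp add: a_def)
  have "\<bar>Arg (u powr of_real a)\<bar> < pi"
    using \<open>u powr of_real a \<noteq> 0\<close> im ln pi_gt_zero by (simp add: Arg_eq_Im_Ln)
  then show "u powr of_real (real d / 6) \<notin> \<real>\<^sub>\<le>\<^sub>0"
    using \<open>u powr of_real a \<noteq> 0\<close> Arg_eq_pi[of "u powr of_real a"] complex_eq_iff[of "u powr of_real a" 0]
    unfolding a_def[symmetric] complex_nonpos_Reals_iff by auto
qed

text \<open>The witness is the point with flat coordinate \<open>s + t * \<omega>\<close>.\<close>

lemma hat_surj: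
  assumes "d \<ge> 3" "0 < s" "0 \<le> t"
  obtains u where "hat d u = s" "hat d (u * rot d (- 1)) = t" "hat d (u * rot d 1) = 0"
proof -
  define a where "a = real d / 6"
  have a: "a > 0" using assms(1) by (simp add: a_def)
  define z where "z = of_real s + of_real t * \<omega>"
  have z: "Re z = s + t / 2" "Im z = t * sqrt 3 / 2"
    by (simp_all add: z_def cos_60 sin_60)
  have "z \<noteq> 0" using z assms by (auto simp: complex_eq_iff)
  have Arg0: "0 \<le> Arg z" "Arg z < pi / 3"
  proof -
    have "Re z > 0" using z assms by simp
    then have "Arg z = arctan (Im z / Re z)"
      using \<open>z \<noteq> 0\<close> by (metis arg_conv_arctan)
    moreover have "Im z / Re z < sqrt 3"
    proof -
      have "t * sqrt 3 / 2 < sqrt 3 * (s + t / 2)"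
        using assms by (simp add: distrib_left)
      then show ?thesis
        using \<open>Re z > 0\<close> unfolding z by (subst pos_divide_less_eq) auto
    qed
    ultimately show "Arg z < pi / 3"
      using arctan_monotone[of "Im z / Re z" "sqrt 3"] tan_60 arctan_tan[of "pi/3"] by simp
    show "0 \<le> Arg z"
      using \<open>Arg z = _\<close> z assms by (simp add: zero_le_arctan_iff)
  qed
  define u where "u = z powr of_real (1 / a)"
  have lnu: "Ln u = of_real (1 / a) * Ln z"
  proof -
    have "\<bar>1 / a * Im (Ln z)\<bar> < pi"
    proof -
      have "1 / a * Im (Ln z) < 1 / a * (pi / 3)"
        using Arg0 a \<open>z \<noteq> 0\<close> by (intro mult_strict_left_mono) (auto simp: Arg_eq_Im_Ln)
      also have "\<dots> = 2 * pi / real d"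
        using assms(1) by (simp add: a_def field_simps)
      also have "\<dots> < pi" using assms(1) by (simp add: field_simps)
      finally show ?thesis
        using Arg0 a \<open>z \<noteq> 0\<close> by (simp add: Arg_eq_Im_Ln)
    qed
    then show ?thesis
      unfolding u_def using \<open>z \<noteq> 0\<close> 
      using a by (simp add: powr_def) (rule Ln_exp, auto simp: abs_less_iff field_simps)
  qed
  have "u \<noteq> 0" using \<open>z \<noteq> 0\<close> by (simp add: u_def)
  have Argu: "Arg u = Arg z / a"
    using \<open>z \<noteq> 0\<close> \<open>u \<noteq> 0\<close> lnu by (simp add: Arg_eq_Im_Ln)
  then have "0 \<le> Arg u"
    using Arg0(1) a by simp
  have "Arg u < 2 * pi / real d"
    using Argu Arg0 assms(1) by (simp add: a_def field_simps)
  then have pos: "0 < hat d u"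
    using hat_pos_iff[of d u] \<open>u \<noteq> 0\<close> \<open>0 \<le> Arg u\<close> assms(1) by simp
  have "u powr of_real a = exp (of_real a * (of_real (1 / a) * Ln z))"
    using \<open>u \<noteq> 0\<close> by (subst powr_def) (simp add: lnu)
  also have "\<dots> = z"
    using a \<open>z \<noteq> 0\<close> by simp
  finally have "z = hat d u + hat d (u * rot d (- 1)) * \<omega>"
    using hat_sector_aux(2)[OF assms(1) pos \<open>0 \<le> Arg u\<close>] by (simp add: a_def)
  then have "Re z = hat d u + hat d (u * rot d (- 1)) / 2" "Im z = hat d (u * rot d (- 1)) * sqrt 3 / 2"
    by (simp_all add: cos_60 sin_60)
  then have "hat d u = s" "hat d (u * rot d (- 1)) = t"
    using z by auto
  then show ?thesis
    using that hat_sector_aux(1)[OF assms(1) pos \<open>0 \<le> Arg u\<close>] by blast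
qed

lemma hat_pos_iff_neq: "0 < hat d w \<longleftrightarrow> hat d w \<noteq> 0"
  using hat_nonneg[of d w] by linarith

section \<open>Oriented triangulations with cyclic links\<close>

text \<open>A closed connected oriented triangulated surface, all of whose vertices have the same degree
  \<open>d\<close>.  Each triangle occurs in \<open>T\<close> as three triples, in its positive cyclic order.  The link of a
  vertex is a cycle of length \<open>d\<close>, indexed by the integers modulo \<open>d\<close>, so that both directions of
  going around the vertex are available without case distinctions.\<close>

locale oriented_triangulation =
  fixes V :: "'v set" and T :: "('v \<times> 'v \<times> 'v) set" and d :: nat
  assumes finite_V: "finite V" and V_nonempty: "V \<noteq> {}"
    and T_vertex: "(a, b, c) \<in> T \<Longrightarrow> a \<in> V"
    and T_rotate: "(a, b, c) \<in> T \<Longrightarrow> (b, c, a) \<in> T"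
    and T_distinct: "(a, b, c) \<in> T \<Longrightarrow> a \<noteq> b"
    and degree_ge_3: "3 \<le> d"
    and cyclic_link: "v \<in> V \<Longrightarrow> \<exists>L :: int \<Rightarrow> 'v.
          (\<forall>j k. L j = L k \<longleftrightarrow> int d dvd j - k) \<and>
          (\<forall>a b. (v, a, b) \<in> T \<longleftrightarrow> (\<exists>k. a = L k \<and> b = L (k + 1)))"
    and connected: "\<lbrakk>S \<subseteq> V; S \<noteq> {}; \<And>a b c. (a, b, c) \<in> T \<Longrightarrow> a \<in> S \<Longrightarrow> b \<in> S\<rbrakk> \<Longrightarrow> S = V"
begin

lemma T_vertices: "(a, b, c) \<in> T \<Longrightarrow> a \<in> V \<and> b \<in> V \<and> c \<in> V"
  using T_vertex[of a b c] T_vertex[of b c a] T_vertex[of c a b] T_rotate[of a b c] T_rotate[of b c a] by blast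

definition link :: "'v \<Rightarrow> int \<Rightarrow> 'v" where
  "link v = (SOME L. (\<forall>j k. L j = L k \<longleftrightarrow> int d dvd j - k) \<and>
          (\<forall>a b. (v, a, b) \<in> T \<longleftrightarrow> (\<exists>k. a = L k \<and> b = L (k + 1))))"

lemma link_eq_iff: "v \<in> V \<Longrightarrow> link v j = link v k \<longleftrightarrow> int d dvd j - k"
  and T_iff_link: "v \<in> V \<Longrightarrow> (v, a, b) \<in> T \<longleftrightarrow> (\<exists>k. a = link v k \<and> b = link v (k + 1))"
  using someI_ex[OF cyclic_link[of v]] unfolding link_def[symmetric] by blast+

lemma link_T: "v \<in> V \<Longrightarrow> (v, link v k, link v (k + 1)) \<in> T"
  using T_iff_link by blast

lemma link_in_V: "v \<in> V \<Longrightarrow> link v k \<in> V"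
  using link_T T_rotate T_vertex by blast

lemma link_neq: "v \<in> V \<Longrightarrow> link v k \<noteq> v"
  using link_T T_distinct by metis

lemma link_mod: "v \<in> V \<Longrightarrow> link v (k mod int d) = link v k"
  by (simp add: link_eq_iff) (metis dvd_minus_mod dvd_diff_commute)

text \<open>Orientability: the two triangles at an edge are seen in opposite order from its two ends.\<close>

lemma link_opposite:
  assumes "v \<in> V" "v' = link v k" "v = link v' k'"
  shows "link v' (k' - 1) = link v (k + 1)" "link v' (k' + 1) = link v (k - 1)"
proof -
  have v': "v' \<in> V" using assms link_in_V by blast
  have "(v', link v (k + 1), v) \<in> T"
    using link_T[OF assms(1), of k] T_rotate assms(2) by blast
  then obtain j where j: "link v (k + 1) = link v' j" "v = link v' (j + 1)"
    using T_iff_link[OF v'] by blast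
  then have "int d dvd (j + 1) - k'"
    using link_eq_iff[OF v'] assms(3) by metis
  then show "link v' (k' - 1) = link v (k + 1)"
    using j link_eq_iff[OF v', of "k' - 1" j] by (simp add: dvd_diff_commute algebra_simps)
  have "(v, link v (k - 1), v') \<in> T"
    using link_T[OF assms(1), of "k - 1"] assms(2) by simp
  then have "(v', v, link v (k - 1)) \<in> T"
    using T_rotate by blast
  then obtain i where i: "v = link v' i" "link v (k - 1) = link v' (i + 1)"
    using T_iff_link[OF v'] by blast
  then have "int d dvd i - k'"
    using link_eq_iff[OF v'] assms(3) by metis
  then show "link v' (k' + 1) = link v (k - 1)"
    using i link_eq_iff[OF v', of "k' + 1" "i + 1"] by (simp add: dvd_diff_commute)
qed

lemma link_sym:
  assumes "v \<in> V" obtains k' where "v = link (link v k) k'"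
  using T_iff_link[of "link v k"] link_T[OF assms, of k] T_rotate link_in_V[OF assms] by blast

definition simplices :: "'v set set" where
  "simplices = {s. \<exists>a b c. (a, b, c) \<in> T \<and> s \<subseteq> {a, b, c}}"

lemma simplex_subset_V: "s \<in> simplices \<Longrightarrow> s \<subseteq> V"
  unfolding simplices_def using T_rotate T_vertex by blast

lemma simplices_down: "s \<in> simplices \<Longrightarrow> s' \<subseteq> s \<Longrightarrow> s' \<in> simplices"
  unfolding simplices_def by blast

lemma simplex_finite: "s \<in> simplices \<Longrightarrow> finite s"
  using simplex_subset_V finite_V finite_subset by blast

lemma simplex_card_le: assumes "s \<in> simplices" shows "card s \<le> 3"
proof -
  obtain a b c where "s \<subseteq> {a, b, c}" using assms unfolding simplices_def by blast
  then have "card s \<le> card {a, b, c}" by (intro card_mono) auto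
  also have "\<dots> \<le> 3" by (simp add: card_insert_if)
  finally show ?thesis .
qed

lemma finite_simplices: "finite simplices"
  by (rule finite_subset[of _ "Pow V"]) (use simplex_subset_V finite_V in auto)

lemma simplex_at_vertex:
  assumes "s \<in> simplices" "v \<in> s"
  obtains k where "s \<subseteq> {v, link v k, link v (k + 1)}"
proof -
  obtain a b c where abc: "(a, b, c) \<in> T" "s \<subseteq> {a, b, c}" using assms unfolding simplices_def by blast
  obtain b' c' where "(v, b', c') \<in> T" "s \<subseteq> {v, b', c'}"
    using abc assms(2) T_rotate by blast
  moreover have "v \<in> V" using assms simplex_subset_V by blast
  ultimately show ?thesis using T_iff_link that by blast
qed

lemma link_simplex: "v \<in> V \<Longrightarrow> s \<subseteq> {v, link v k, link v (k + 1)} \<Longrightarrow> s \<in> simplices"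
  unfolding simplices_def using link_T by blast

section \<open>Charts in barycentric coordinates\<close>

text \<open>The points of the abstract polyhedron, as barycentric coordinates supported in a simplex.\<close>

definition weights :: "('v \<Rightarrow> real) set" where
  "weights = {t. (\<forall>v. 0 \<le> t v) \<and> sum t V = 1 \<and> {v. t v \<noteq> 0} \<in> simplices}"

text \<open>One minus the barycentric coordinate of the central vertex; the star of the vertex is the set
  where it is below 1.\<close>

definition gauge :: "complex \<Rightarrow> real" where
  "gauge w = (\<Sum>j = 0..<int d. hat d (w * rot d (- j)))"

text \<open>The inverse chart at \<open>v\<close>: the barycentric coordinates of the point of the star of \<open>v\<close>
  with complex coordinate \<open>w\<close>.  Defining the inverse by a single formula avoids pasting together maps
  on triangles, and continuity is immediate.\<close>

definition wt :: "'v \<Rightarrow> complex \<Rightarrow> 'v \<Rightarrow> real" where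
  "wt v w u = (if u = v then 1 - gauge w
     else (\<Sum>j \<in> {j \<in> {0..<int d}. link v j = u}. hat d (w * rot d (- j))))"

lemma d_pos: "0 < d" using degree_ge_3 by simp

lemma hat_rot_mod: "hat d (w * rot d (- (k mod int d))) = hat d (w * rot d (- k))"
proof -
  have "- k = - (k mod int d) + int d * - (k div int d)"
    by (simp add: algebra_simps) 
  then show ?thesis using rot_period[OF d_pos] by metis
qed

lemma hat_le_gauge: "hat d (w * rot d (- k)) \<le> gauge w"
proof -
  have "hat d (w * rot d (- (k mod int d))) \<le> gauge w"
    unfolding gauge_def using d_pos by (intro member_le_sum) auto
  then show ?thesis by (simp add: hat_rot_mod)
qed

lemma wt_centre [simp]: "wt v w v = 1 - gauge w"
  by (simp add: wt_def)

text \<open>Valid for every integer \<open>k\<close>, since both sides are periodic.\<close>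

lemma wt_link:
  assumes "v \<in> V" shows "wt v w (link v k) = hat d (w * rot d (- k))"
proof -
  have "{j \<in> {0..<int d}. link v j = link v k} = {k mod int d}"
  proof -
    have "j = k mod int d" if "0 \<le> j" "j < int d" "int d dvd j - k" for j
      using that by (metis mod_eq_dvd_iff mod_pos_pos_trivial)
    then show ?thesis
      using link_eq_iff[OF assms] link_mod[OF assms, of k] d_pos by auto
  qed
  then show ?thesis
    using link_neq[OF assms] by (simp add: wt_def hat_rot_mod)
qed

lemma wt_off: "v \<in> V \<Longrightarrow> u \<noteq> v \<Longrightarrow> u \<notin> range (link v) \<Longrightarrow> wt v w u = 0"
  unfolding wt_def by (auto intro!: sum.neutral)

lemma wt_sum: assumes "v \<in> V" shows "sum (wt v w) V = 1"
proof -
  have "sum (wt v w) V = wt v w v + sum (wt v w) (V - {v})"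
    using assms finite_V by (rule sum.remove[rotated])
  also have "sum (wt v w) (V - {v}) =
      (\<Sum>u \<in> V - {v}. \<Sum>j \<in> {j \<in> {0..<int d}. link v j = u}. hat d (w * rot d (- j)))"
    by (intro sum.cong) (auto simp: wt_def)
  also have "\<dots> = gauge w"
    unfolding gauge_def using assms finite_V link_in_V link_neq by (intro sum.group) auto
  finally show ?thesis by simp
qed

lemma wt_nonneg: "gauge w \<le> 1 \<Longrightarrow> 0 \<le> wt v w u"
  unfolding wt_def by (auto intro: sum_nonneg)

lemma hat_support_link:
  assumes "v \<in> V" "0 < hat d (w * rot d (- k))" "0 < hat d (w * rot d (- j))"
  shows "link v j \<in> {link v (k - 1), link v k, link v (k + 1)}"
proof -
  have "w * rot d (- j) = w * rot d (- k) * rot d (- (j - k))"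
    by (simp add: mult.assoc flip: rot_add)
  then obtain n where n: "\<bar>(j - k) - int d * n\<bar> \<le> 1"
    using hat_support[OF degree_ge_3 assms(2)] assms(3) by metis
  then have "j - k - int d * n = -1 \<or> j - k - int d * n = 0 \<or> j - k - int d * n = 1" by linarith
  then have "j - (k - 1) = int d * n \<or> j - k = int d * n \<or> j - (k + 1) = int d * n" by linarith
  then show ?thesis using link_eq_iff[OF assms(1)] by auto
qed

lemma hat_next:
  "hat d (w * rot d (- (k + 1))) = hat d (w * rot d (- k) * rot d (- 1))"
  "hat d (w * rot d (- (k - 1))) = hat d (w * rot d (- k) * rot d 1)"
  by (simp_all add: mult.assoc flip: rot_add)

text \<open>At most two hats, of adjacent axes, are positive at a given point, so the point lies in a
  triangle at \<open>v\<close>.\<close>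

lemma wt_support:
  assumes "v \<in> V" shows "{u. wt v w u \<noteq> 0} \<in> simplices"
proof (cases "w = 0")
  case True
  then have "wt v w u = 0" if "u \<noteq> v" for u
    using that by (simp add: wt_def)
  then have "{u. wt v w u \<noteq> 0} \<subseteq> {v, link v 0, link v (0 + 1)}" by blast
  then show ?thesis using assms link_simplex by blast
next
  case False
  obtain k where k: "0 < hat d (w * rot d (- k))"
    using exists_hat_pos[OF degree_ge_3 False] .
  have sub: "{u. wt v w u \<noteq> 0} \<subseteq> {v, link v (k - 1), link v k, link v (k + 1)}"
  proof (intro subsetI, rule ccontr)
    fix u assume "u \<in> {u. wt v w u \<noteq> 0}" "u \<notin> {v, link v (k - 1), link v k, link v (k + 1)}"
    then have u: "wt v w u \<noteq> 0" "u \<noteq> v" "u \<notin> {link v (k - 1), link v k, link v (k + 1)}"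
      by auto
    then obtain j where j: "u = link v j" using wt_off[OF assms] by blast
    then have "0 < hat d (w * rot d (- j))"
      using u(1) wt_link[OF assms] by (simp add: hat_pos_iff_neq)
    from hat_support_link[OF assms k this] show False using u(3) j by blast
  qed
  have "wt v w (link v (k + 1)) = 0 \<or> wt v w (link v (k - 1)) = 0"
    using hat_neighbours_exclusive[OF degree_ge_3 k] wt_link[OF assms] hat_next by metis
  then show ?thesis
  proof
    assume "wt v w (link v (k + 1)) = 0"
    then have "{u. wt v w u \<noteq> 0} \<subseteq> {v, link v (k - 1), link v (k - 1 + 1)}"
      using sub by auto
    then show ?thesis by (rule link_simplex[OF assms])
  next
    assume "wt v w (link v (k - 1)) = 0"
    then have "{u. wt v w u \<noteq> 0} \<subseteq> {v, link v k, link v (k + 1)}"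
      using sub by auto
    then show ?thesis by (rule link_simplex[OF assms])
  qed
qed

lemma wt_in_weights: "v \<in> V \<Longrightarrow> gauge w \<le> 1 \<Longrightarrow> wt v w \<in> weights"
  using wt_nonneg wt_sum wt_support unfolding weights_def by blast

lemma wt_power:
  assumes "v \<in> V" "0 < wt v w (link v k)"
  shows "(w * rot d (- k)) powr of_real (real d / 6) =
    wt v w (link v k) + wt v w (link v (k + 1)) * \<omega> + wt v w (link v (k - 1)) * cnj \<omega>"
  using hat_sector[OF degree_ge_3, of "w * rot d (- k)"] assms by (simp only: wt_link hat_next)

lemma unrotate: "w * rot d (- k) * rot d k = w"
  by (simp add: mult.assoc flip: rot_add)

lemma wt_inj:
  assumes "v \<in> V" "wt v w = wt v w'" shows "w = w'"
proof -
  have h: "hat d (w * rot d (- k)) = hat d (w' * rot d (- k))" for k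
    using wt_link[OF assms(1)] assms(2) by metis
  show ?thesis
  proof (cases "w = 0")
    case True
    then have "\<not> 0 < hat d (w' * rot d (- k))" for k
      using h[of k] by simp
    then have "w' = 0" using exists_hat_pos[OF degree_ge_3] by metis
    then show ?thesis using True by simp
  next
    case False
    then obtain k where k: "0 < hat d (w * rot d (- k))"
      using exists_hat_pos[OF degree_ge_3] by metis
    have "0 < wt v w (link v k)" "0 < wt v w' (link v k)"
      using k h wt_link[OF assms(1)] by simp_all
    then have "(w * rot d (- k)) powr of_real (real d / 6) = (w' * rot d (- k)) powr of_real (real d / 6)"
      by (simp only: wt_power[OF assms(1)] assms(2))
    moreover have "0 < hat d (w' * rot d (- k))" using k h by simp
    ultimately have "w * rot d (- k) = w' * rot d (- k)"
      using powr_hat_inverse(1)[OF degree_ge_3] k by metis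
    then show ?thesis by simp
  qed
qed

lemma weights_wtI:
  assumes "v \<in> V" "t \<in> weights" "\<And>j. t (link v j) = hat d (w * rot d (- j))"
    "\<And>u. u \<noteq> v \<Longrightarrow> u \<notin> range (link v) \<Longrightarrow> t u = 0"
  shows "wt v w = t"
proof -
  have ne: "wt v w u = t u" if "u \<noteq> v" for u
    using that assms wt_link wt_off by (cases "u \<in> range (link v)") auto
  have "wt v w v = sum (wt v w) V - sum (wt v w) (V - {v})"
    using assms(1) finite_V by (simp add: sum.remove)
  also have "\<dots> = sum t V - sum t (V - {v})"
    using sum.cong[of "V - {v}" "V - {v}" "wt v w" t] ne wt_sum assms(1,2) by (simp add: weights_def)
  also have "\<dots> = t v"
    using assms(1) finite_V by (simp add: sum.remove)
  finally show ?thesis using ne by (metis ext)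
qed

text \<open>A point of the star lies in a triangle \<open>{v, link v k, link v (k + 1)}\<close>.  Its complex coordinate is
  built on the axis of a neighbour of positive weight: the first one if possible, otherwise the second
  one, in which case the point is on that axis.\<close>

lemma wt_surj:
  assumes "v \<in> V" "t \<in> weights" "0 < t v"
  obtains w where "gauge w < 1" "wt v w = t"
proof -
  have "\<exists>w. wt v w = t"
  proof -
    obtain k where k: "{u. t u \<noteq> 0} \<subseteq> {v, link v k, link v (k + 1)}"
      using simplex_at_vertex[of "{u. t u \<noteq> 0}" v] assms unfolding weights_def by auto
    have nn: "0 \<le> t u" for u using assms unfolding weights_def by blast
    have off: "t u = 0" if "u \<noteq> v" "u \<notin> range (link v)" for u
      using k that by blast
    have next_ne: "link v (i + 1) \<noteq> link v i" "link v (i - 1) \<noteq> link v i" "link v (i + 1) \<noteq> link v (i - 1)" for i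
      using link_eq_iff[OF assms(1)] degree_ge_3 by (auto dest: zdvd_imp_le)
    have main: "\<exists>w. wt v w = t" if i: "0 < t (link v i)" "t (link v (i - 1)) = 0"
      "{u. t u \<noteq> 0} \<subseteq> {v, link v i, link v (i + 1)}" for i
    proof -
      obtain u where u: "hat d u = t (link v i)" "hat d (u * rot d (- 1)) = t (link v (i + 1))"
          "hat d (u * rot d 1) = 0"
        using hat_surj[OF degree_ge_3 i(1) nn] by metis
      define w where "w = u * rot d i"
      have w: "w * rot d (- i) = u" using unrotate[of u "- i"] by (simp add: w_def)
      have h: "hat d (w * rot d (- i)) = t (link v i)" "hat d (w * rot d (- (i + 1))) = t (link v (i + 1))"
          "hat d (w * rot d (- (i - 1))) = t (link v (i - 1))"
        using u i(2) by (simp_all only: hat_next w)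
      have "t (link v j) = hat d (w * rot d (- j))" for j
      proof (cases "link v j \<in> {link v (i - 1), link v i, link v (i + 1)}")
        case True
        then show ?thesis using h wt_link[OF assms(1)] by (metis empty_iff insertE)
      next
        case False
        then have "\<not> 0 < hat d (w * rot d (- j))"
          using hat_support_link[OF assms(1), of w i j] i h by metis
        then have "hat d (w * rot d (- j)) = 0"
          using hat_pos_iff_neq by blast
        moreover have "t (link v j) = 0" using False i(3) link_neq[OF assms(1)] by auto
        ultimately show ?thesis by simp
      qed
      then show ?thesis using weights_wtI[OF assms(1,2) _ off] by metis
    qed
    consider "t (link v k) > 0" | "t (link v k) = 0" "t (link v (k + 1)) > 0" | "t (link v k) = 0" "t (link v (k + 1)) = 0"
      using nn[of "link v k"] nn[of "link v (k + 1)"] by linarith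
    then show ?thesis
    proof cases
      case 1
      have "t (link v (k - 1)) = 0"
        using k next_ne[of k] link_neq[OF assms(1)] by auto
      then show ?thesis using main[of k] 1 k by blast
    next
      case 2
      then show ?thesis using main[of "k + 1"] k by auto
    next
      case 3
      then have "t u = 0" if "u \<noteq> v" for u using k that by auto
      then have "wt v 0 = t"
        using weights_wtI[OF assms(1,2), of 0] link_neq[OF assms(1)] by simp
      then show ?thesis by blast
    qed
  qed
  then obtain w where "wt v w = t" by blast
  then show ?thesis using that[of w] assms(3) by auto
qed

text \<open>The flat coordinates of a point seen from the two ends of an edge of length 1 add up to 1.  Here
  \<open>k\<close> and \<open>k'\<close> are the positions of the two ends in each other's links.\<close>

definition transition :: "int \<Rightarrow> int \<Rightarrow> complex \<Rightarrow> complex" where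
  "transition k k' w = (1 - (w * rot d (- k)) powr of_real (real d / 6)) powr of_real (6 / real d) * rot d k'"

text \<open>Comparing the flat coordinates from both ends, by means of \<open>1 - \<omega> = cnj \<omega>\<close>, gives the
  transition formula.  That the point has positive weight at both ends keeps the powers away from the
  branch cut.\<close>

lemma wt_transition:
  assumes "v \<in> V" "v' = link v k" "v = link v' k'" "wt v w = wt v' w'" "gauge w < 1" "gauge w' < 1"
  shows "w' = transition k k' w"
    and "w * rot d (- k) \<notin> \<real>\<^sub>\<le>\<^sub>0"
    and "1 - (w * rot d (- k)) powr of_real (real d / 6) \<notin> \<real>\<^sub>\<le>\<^sub>0"
proof -
  have v': "v' \<in> V" using assms link_in_V by blast
  have pos: "0 < wt v w (link v k)" "0 < wt v' w' (link v' k')"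
    using assms(2-6) wt_centre by (metis diff_gt_0_iff_gt)+
  then have hp: "0 < hat d (w * rot d (- k))" "0 < hat d (w' * rot d (- k'))"
    using wt_link assms(1) v' by metis+
  let ?t = "wt v w"
  let ?s = "?t v'" and ?p = "?t (link v (k + 1))" and ?m = "?t (link v (k - 1))"
  note opp = link_opposite[OF assms(1-3)]
  have u: "(w * rot d (- k)) powr of_real (real d / 6) = ?s + ?p * \<omega> + ?m * cnj \<omega>"
    using wt_power[OF assms(1) pos(1)] assms(2) by simp
  have u': "(w' * rot d (- k')) powr of_real (real d / 6) = ?t v + ?m * \<omega> + ?p * cnj \<omega>"
    using wt_power[OF v' pos(2)] assms(3,4) opp by simp
  have "?t v + ?s + ?p + ?m = 1"
  proof -
    have sum4: "sum f {a, b, c, e} = f a + f b + f c + f e"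
      if "a \<noteq> b" "a \<noteq> c" "a \<noteq> e" "b \<noteq> c" "b \<noteq> e" "c \<noteq> e" for a b c e :: 'v and f :: "'v \<Rightarrow> real"
      using that by simp
    have ne: "link v (k + 1) \<noteq> link v k" "link v (k - 1) \<noteq> link v k" "link v (k + 1) \<noteq> link v (k - 1)"
      using link_eq_iff[OF assms(1)] degree_ge_3 by (auto dest: zdvd_imp_le)
    have "?t x = 0" if "x \<notin> {v, v', link v (k + 1), link v (k - 1)}" for x
    proof (cases "x \<in> range (link v)")
      case True
      then obtain j where j: "x = link v j" by blast
      then have "\<not> 0 < hat d (w * rot d (- j))"
        using hat_support_link[OF assms(1) hp(1), of j] that assms(2) by auto
      then show ?thesis
        using j wt_link[OF assms(1)] by (simp add: hat_pos_iff_neq)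
    qed (use that wt_off[OF assms(1)] in auto)
    then have "sum ?t {v, v', link v (k + 1), link v (k - 1)} = sum ?t V"
      using assms(1) v' link_in_V[OF assms(1)] finite_V by (intro sum.mono_neutral_left) auto
    then show ?thesis
      using wt_sum[OF assms(1), of w] sum4[of v v' "link v (k + 1)" "link v (k - 1)" ?t] ne
        link_neq[OF assms(1)] assms(2) by metis
  qed
  then have "?t v = 1 - ?s - ?p - ?m"
    by linarith
  from arg_cong[OF this, of complex_of_real] have e1: "complex_of_real (?t v) = 1 - complex_of_real ?s - complex_of_real ?p - complex_of_real ?m"
    by (simp only: of_real_diff of_real_1)
  have e2: "cnj \<omega> = 1 - \<omega>"
    by (simp add: complex_eq_iff cos_60)
  have alg: "A + m * z + p * z' = 1 - (s + p * z + m * z')"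
    if "A = 1 - s - p - m" "z' = 1 - z" for A m p s z z' :: complex
    unfolding that by (simp add: algebra_simps)
  have eq: "(w' * rot d (- k')) powr of_real (real d / 6) = 1 - (w * rot d (- k)) powr of_real (real d / 6)"
    unfolding u u' by (rule alg[OF e1 e2])
  have "w' * rot d (- k') = (1 - (w * rot d (- k)) powr of_real (real d / 6)) powr of_real (6 / real d)"
    using powr_hat_inverse(1)[OF degree_ge_3 hp(2)] eq by simp
  then show "w' = transition k k' w"
    unfolding transition_def by (metis unrotate)
  show "w * rot d (- k) \<notin> \<real>\<^sub>\<le>\<^sub>0"
    using powr_hat_inverse(3)[OF degree_ge_3 hp(1)] .
  show "1 - (w * rot d (- k)) powr of_real (real d / 6) \<notin> \<real>\<^sub>\<le>\<^sub>0"
    using powr_hat_inverse(2)[OF degree_ge_3 hp(2)] eq by simp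
qed

lemma continuous_on_wt: "continuous_on UNIV (\<lambda>w. wt v w u)"
  and continuous_on_gauge: "continuous_on UNIV gauge"
proof -
  have h: "continuous_on UNIV (\<lambda>w. hat d (w * rot d (- j)))" for j
    by (rule continuous_on_compose2[OF continuous_on_hat[OF d_pos]]) (auto intro!: continuous_intros)
  show g: "continuous_on UNIV gauge"
    unfolding gauge_def by (intro continuous_intros h)
  show "continuous_on UNIV (\<lambda>w. wt v w u)"
    unfolding wt_def using g h by (cases "u = v") (auto intro!: continuous_intros)
qed

text \<open>Each hat is bounded by the gauge, so the flat coordinate has norm at most 3.\<close>

lemma compact_gauge_le_1: "compact {w. gauge w \<le> 1}"
proof -
  have "norm w \<le> 3 powr (6 / real d)" if "gauge w \<le> 1" for w
  proof (cases "w = 0")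
    case False
    then obtain k where k: "0 < hat d (w * rot d (- k))"
      using exists_hat_pos[OF degree_ge_3] by metis
    define u where "u = w * rot d (- k)"
    have le: "\<bar>hat d (w * rot d (- j))\<bar> \<le> 1" for j
      using hat_le_gauge[of w j] that by simp
    have l3: "\<bar>hat d u\<bar> \<le> 1" "\<bar>hat d (u * rot d (- 1))\<bar> \<le> 1" "\<bar>hat d (u * rot d 1)\<bar> \<le> 1"
      using le[of k] le[of "k + 1"] le[of "k - 1"] by (simp_all only: u_def hat_next)
    have "norm (u powr of_real (real d / 6)) \<le> norm (complex_of_real (hat d u)) +
        norm (hat d (u * rot d (- 1)) * \<omega>) + norm (hat d (u * rot d 1) * cnj \<omega>)"
      using hat_sector[OF degree_ge_3, of u] k norm_triangle_le norm_triangle_ineq unfolding u_def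
      by (metis (no_types, lifting) add_mono order_refl)
    also have "\<dots> \<le> 3" using l3 by (simp add: norm_mult)
    finally have "norm u powr (real d / 6) \<le> 3"
      by (simp add: norm_powr_real_powr')
    then have "(norm u powr (real d / 6)) powr (6 / real d) \<le> 3 powr (6 / real d)"
      by (intro powr_mono2) auto
    then show ?thesis
      using d_pos by (simp add: powr_powr u_def norm_mult)
  qed simp
  then have "bounded {w. gauge w \<le> 1}"
    by (intro boundedI) auto
  moreover have "closed {w. gauge w \<le> 1}"
    using continuous_on_gauge by (intro closed_Collect_le) auto
  ultimately show ?thesis by (simp add: compact_eq_bounded_closed)
qed

lemma open_gauge_less_1: "open {w. gauge w < 1}"
  using continuous_on_gauge by (intro open_Collect_less) auto

end

section \<open>The Riemann surface of a geometric triangulation\<close>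

text \<open>Two simplices have at most six vertices together, so affine independence of any six vertices
  makes the hulls of the simplices meet only in common faces.\<close>

locale geometric_triangulation = oriented_triangulation V T d
  for V :: "'v set" and T :: "('v \<times> 'v \<times> 'v) set" and d :: nat +
  fixes P :: "'v \<Rightarrow> 'e::euclidean_space"
  assumes inj_P: "inj_on P V"
    and general_position: "\<lbrakk>S \<subseteq> V; card S \<le> 6\<rbrakk> \<Longrightarrow> \<not> affine_dependent (P ` S)"
begin

definition point :: "('v \<Rightarrow> real) \<Rightarrow> 'e" where
  "point t = (\<Sum>v\<in>V. t v *\<^sub>R P v)"

definition polyhedron :: "'e set" where
  "polyhedron = point ` weights"

lemma weights_nonneg: "t \<in> weights \<Longrightarrow> 0 \<le> t v"
  unfolding weights_def by blast

lemma point_inj: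
  assumes "t \<in> weights" "t' \<in> weights" "point t = point t'" shows "t = t'"
proof -
  define S where "S = {v. t v \<noteq> 0} \<union> {v. t' v \<noteq> 0}"
  have st: "{v. t v \<noteq> 0} \<in> simplices" "{v. t' v \<noteq> 0} \<in> simplices"
    using assms unfolding weights_def by auto
  have SV: "S \<subseteq> V" unfolding S_def using st simplex_subset_V by blast
  have finS: "finite S" using SV finite_V finite_subset by blast
  have "card S \<le> card {v. t v \<noteq> 0} + card {v. t' v \<noteq> 0}"
    unfolding S_def by (rule card_Un_le)
  then have "card S \<le> 6" using simplex_card_le[OF st(1)] simplex_card_le[OF st(2)] by linarith
  then have nd: "\<not> affine_dependent (P ` S)" using general_position SV by blast
  have injS: "inj_on P S" using inj_P SV inj_on_subset by blast
  \<comment> \<open>The difference of the weights is an affine relation between at most six vertices.\<close>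
  define U where "U x = (t - t') (inv_into S P x)" for x
  have U: "U (P v) = t v - t' v" if "v \<in> S" for v
    using that injS by (simp add: U_def)
  have off: "t v = 0" "t' v = 0" if "v \<notin> S" for v using that unfolding S_def by auto
  have "sum U (P ` S) = (\<Sum>v\<in>S. t v - t' v)"
    by (subst sum.reindex[OF injS]) (simp add: U)
  also have "\<dots> = (\<Sum>v\<in>V. t v - t' v)"
    using SV finite_V off by (intro sum.mono_neutral_left) auto
  also have "\<dots> = 0" using assms(1,2) by (simp add: sum_subtractf weights_def)
  finally have s0: "sum U (P ` S) = 0" .
  have "(\<Sum>x\<in>P ` S. U x *\<^sub>R x) = (\<Sum>v\<in>S. (t v - t' v) *\<^sub>R P v)"
    by (subst sum.reindex[OF injS]) (simp add: U)
  also have "\<dots> = (\<Sum>v\<in>V. (t v - t' v) *\<^sub>R P v)"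
    using SV finite_V off by (intro sum.mono_neutral_left) auto
  also have "\<dots> = point t - point t'"
    by (simp add: point_def sum_subtractf scaleR_diff_left)
  finally have s1: "(\<Sum>x\<in>P ` S. U x *\<^sub>R x) = 0" using assms(3) by simp
  have "\<forall>x\<in>P ` S. U x = 0"
    using nd s0 s1 finS affine_dependent_explicit_finite[of "P ` S"] by blast
  then have "t v = t' v" for v using U off by (cases "v \<in> S") auto
  then show ?thesis by blast
qed

lemma hull_simplex_eq:
  assumes "s \<in> simplices"
  shows "convex hull (P ` s) = point ` {t \<in> weights. {v. t v \<noteq> 0} \<subseteq> s}"
proof -
  have sV: "s \<subseteq> V" and fs: "finite s" using assms simplex_subset_V simplex_finite by auto
  have injs: "inj_on P s" using inj_P sV inj_on_subset by blast
  show ?thesis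
  proof (intro equalityI subsetI)
    fix x assume "x \<in> convex hull (P ` s)"
    then obtain u where u: "\<forall>y\<in>P ` s. 0 \<le> u y" "sum u (P ` s) = 1" "(\<Sum>y\<in>P ` s. u y *\<^sub>R y) = x"
      using fs by (auto simp: convex_hull_finite)
    define t where "t v = (if v \<in> s then u (P v) else 0)" for v
    have sup: "{v. t v \<noteq> 0} \<subseteq> s" by (auto simp: t_def)
    have "sum t V = sum t s"
      using sV finite_V by (intro sum.mono_neutral_right) (auto simp: t_def)
    also have "\<dots> = 1"
      using u(2) injs by (simp add: t_def sum.reindex)
    finally have "t \<in> weights"
      unfolding weights_def using u(1) sup simplices_down[OF assms] by (auto simp: t_def)
    have "point t = (\<Sum>v\<in>s. t v *\<^sub>R P v)"
      unfolding point_def using sV finite_V by (intro sum.mono_neutral_right) (auto simp: t_def)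
    also have "\<dots> = x"
      using u(3) injs by (simp add: t_def sum.reindex)
    finally show "x \<in> point ` {t \<in> weights. {v. t v \<noteq> 0} \<subseteq> s}"
      using sup \<open>t \<in> weights\<close> by blast
  next
    fix x assume "x \<in> point ` {t \<in> weights. {v. t v \<noteq> 0} \<subseteq> s}"
    then obtain t where t: "x = point t" "t \<in> weights" "{v. t v \<noteq> 0} \<subseteq> s" by blast
    define u where "u y = t (inv_into s P y)" for y
    have u: "u (P v) = t v" if "v \<in> s" for v using injs that by (simp add: u_def)
    have "sum u (P ` s) = sum t s"
      using injs by (simp add: sum.reindex u)
    also have "\<dots> = sum t V"
      using sV finite_V t(3) by (intro sum.mono_neutral_left) auto
    finally have "sum u (P ` s) = 1" using t(2) unfolding weights_def by simp
    moreover have "(\<Sum>y\<in>P ` s. u y *\<^sub>R y) = (\<Sum>v\<in>s. t v *\<^sub>R P v)"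
      using injs by (simp add: sum.reindex u)
    moreover have "\<dots> = x"
      unfolding t(1) point_def using sV finite_V t(3) by (intro sum.mono_neutral_left) auto
    moreover have "\<forall>y\<in>P ` s. 0 \<le> u y"
      using u weights_nonneg[OF t(2)] by auto
    ultimately show "x \<in> convex hull (P ` s)"
      using fs by (subst convex_hull_finite) auto
  qed
qed

lemma polyhedron_eq_Union: "polyhedron = (\<Union>s\<in>simplices. convex hull (P ` s))"
proof -
  have "(\<Union>s\<in>simplices. convex hull (P ` s)) = (\<Union>s\<in>simplices. point ` {t \<in> weights. {v. t v \<noteq> 0} \<subseteq> s})"
    using hull_simplex_eq by simp
  also have "\<dots> = polyhedron"
    unfolding polyhedron_def weights_def by blast
  finally show ?thesis by simp
qed

lemma compact_hull: "s \<in> simplices \<Longrightarrow> compact (convex hull (P ` s))"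
  by (simp add: finite_imp_compact_convex_hull simplex_finite)

lemma compact_polyhedron: "compact polyhedron"
  unfolding polyhedron_eq_Union using finite_simplices compact_hull by blast

lemma vertex_in_polyhedron: "v \<in> V \<Longrightarrow> P v \<in> polyhedron"
  unfolding polyhedron_eq_Union
  using link_simplex[of v "{v}" 0] by (intro UN_I[of "{v}"]) auto

lemma connected_polyhedron: "Topological_Spaces.connected polyhedron"
proof -
  obtain v0 where v0: "v0 \<in> V" using V_nonempty by blast
  have cc: "connected_component polyhedron x y"
    if "s \<in> simplices" "x \<in> convex hull (P ` s)" "y \<in> convex hull (P ` s)" for s x y
    unfolding connected_component_def using that polyhedron_eq_Union
    by (intro exI[of _ "convex hull (P ` s)"]) (auto intro: convex_connected)
  define S where "S = {v \<in> V. connected_component polyhedron (P v0) (P v)}"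
  have "S = V"
  proof (rule connected)
    show "S \<subseteq> V" by (auto simp: S_def)
    show "S \<noteq> {}" using v0 vertex_in_polyhedron by (auto simp: S_def)
    fix a b c assume abc: "(a, b, c) \<in> T" "a \<in> S"
    then have "connected_component polyhedron (P a) (P b)"
      by (intro cc[of "{a, b, c}"]) (auto simp: simplices_def hull_inc)
    then show "b \<in> S" using abc T_vertex T_rotate
      unfolding S_def by (blast intro: connected_component_trans)
  qed
  have "connected_component polyhedron (P v0) x" if x: "x \<in> polyhedron" for x
  proof -
    obtain s where s: "s \<in> simplices" "x \<in> convex hull (P ` s)"
      using x polyhedron_eq_Union by blast
    then obtain v where v: "v \<in> s" by fastforce
    then have "connected_component polyhedron (P v) x"
      using s by (intro cc[of s]) (auto simp: hull_inc)
    moreover have "v \<in> S" using v s simplex_subset_V \<open>S = V\<close> by blast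
    ultimately show ?thesis unfolding S_def by (blast intro: connected_component_trans)
  qed
  then show ?thesis
    unfolding connected_iff_connected_component
    by (blast intro: connected_component_trans connected_component_sym)
qed

definition star :: "'v \<Rightarrow> 'e set" where
  "star v = point ` {t \<in> weights. 0 < t v}"

definition unchart :: "'v \<Rightarrow> complex \<Rightarrow> 'e" where
  "unchart v w = point (wt v w)"

definition disc :: "complex set" where
  "disc = {w. gauge w < 1}"

definition chart :: "'v \<Rightarrow> 'e \<Rightarrow> complex" where
  "chart v = inv_into disc (unchart v)"

definition atlas :: "('e set \<times> ('e \<Rightarrow> complex)) set" where
  "atlas = (\<lambda>v. (star v, chart v)) ` V"

lemma star_subset: "star v \<subseteq> polyhedron"
  unfolding star_def polyhedron_def by blast

text \<open>The complement of the star is the finite union of the closed simplices that avoid \<open>v\<close>.\<close>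

lemma openin_star: 
  "openin (top_of_set polyhedron) (star v)"
proof -
  have "star v = polyhedron - (\<Union>s\<in>{s \<in> simplices. v \<notin> s}. convex hull (P ` s))"
  proof -
    have "(\<Union>s\<in>{s \<in> simplices. v \<notin> s}. convex hull (P ` s)) = point ` {t \<in> weights. t v = 0}"
    proof -
      have "(\<Union>s\<in>{s \<in> simplices. v \<notin> s}. convex hull (P ` s)) =
        (\<Union>s\<in>{s \<in> simplices. v \<notin> s}. point ` {t \<in> weights. {v. t v \<noteq> 0} \<subseteq> s})"
        using hull_simplex_eq by simp
      also have "\<dots> = point ` {t \<in> weights. t v = 0}"
        unfolding weights_def by blast
      finally show ?thesis .
    qed
    moreover have "inj_on point weights" using point_inj by (intro inj_onI) 
    moreover have "{t \<in> weights. 0 < t v} = weights - {t \<in> weights. t v = 0}"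
      using weights_nonneg by (auto simp: order_less_le)
    ultimately show ?thesis
      unfolding star_def polyhedron_def using inj_on_image_set_diff[of point weights weights "{t \<in> weights. t v = 0}"] by auto
  qed
  moreover have "closed (\<Union>s\<in>{s \<in> simplices. v \<notin> s}. convex hull (P ` s))"
    using finite_simplices compact_hull by (intro compact_imp_closed compact_UN) auto
  ultimately show ?thesis
    using openin_open_Int[OF open_Compl] Diff_eq by metis
qed

lemma unchart_inj: "v \<in> V \<Longrightarrow> inj_on (unchart v) {w. gauge w \<le> 1}"
  unfolding unchart_def using point_inj wt_in_weights wt_inj by (intro inj_onI) blast

lemma unchart_disc: assumes "v \<in> V" shows "unchart v ` disc = star v"
proof
  show "unchart v ` disc \<subseteq> star v"
    unfolding unchart_def star_def disc_def using assms wt_in_weights by fastforce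
  show "star v \<subseteq> unchart v ` disc"
  proof
    fix x assume "x \<in> star v"
    then obtain t where t: "t \<in> weights" "0 < t v" "x = point t" unfolding star_def by blast
    from wt_surj[OF assms t(1,2)] show "x \<in> unchart v ` disc"
      unfolding unchart_def disc_def t(3) by blast
  qed
qed

lemma inj_on_disc: "v \<in> V \<Longrightarrow> inj_on (unchart v) disc"
  by (rule inj_on_subset[OF unchart_inj]) (auto simp: disc_def)

lemma chart_unchart: "v \<in> V \<Longrightarrow> w \<in> disc \<Longrightarrow> chart v (unchart v w) = w"
  unfolding chart_def using inj_on_disc by simp

lemma chart_in_disc: "v \<in> V \<Longrightarrow> x \<in> star v \<Longrightarrow> chart v x \<in> disc"
  unfolding chart_def using unchart_disc inv_into_into by metis

lemma unchart_chart: "v \<in> V \<Longrightarrow> x \<in> star v \<Longrightarrow> unchart v (chart v x) = x"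
  unfolding chart_def using unchart_disc f_inv_into_f by metis

lemma chart_image: "v \<in> V \<Longrightarrow> chart v ` star v = disc"
  using chart_unchart chart_in_disc unchart_disc by (metis (no_types, lifting) image_eqI subsetI subset_antisym image_subsetI)

lemma continuous_on_unchart: "continuous_on A (unchart v)"
  unfolding unchart_def point_def
  by (intro continuous_intros continuous_on_subset[OF continuous_on_wt]) auto

text \<open>A continuous injection of the compact set \<open>gauge w \<le> 1\<close> is a homeomorphism onto its image;
  this is then restricted to the open star.\<close>

lemma homeomorphism_chart:
  assumes "v \<in> V" shows "homeomorphism (star v) disc (chart v) (unchart v)"
proof -
  obtain g where "homeomorphism {w. gauge w \<le> 1} (unchart v ` {w. gauge w \<le> 1}) (unchart v) g"
    using homeomorphism_compact[OF compact_gauge_le_1 continuous_on_unchart refl unchart_inj[OF assms]] by blast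
  then have h: "homeomorphism disc (star v) (unchart v) g"
    by (rule homeomorphism_of_subsets) (auto simp: disc_def unchart_disc[OF assms, unfolded disc_def])
  then have "g x = chart v x" if "x \<in> star v" for x
    using that assms chart_unchart unchart_disc unfolding homeomorphism_def by (metis imageE)
  then have "homeomorphism disc (star v) (unchart v) (chart v)"
    using homeomorphism_cong[OF h] by auto
  then show ?thesis by (rule homeomorphism_symD)
qed

lemma inv_into_chart:
  assumes "v \<in> V" "w \<in> disc" shows "inv_into (star v) (chart v) w = unchart v w"
  using assms homeomorphism_chart[OF assms(1)] unfolding homeomorphism_def
  by (intro inv_into_f_eq) (auto intro: inj_on_inverseI)

lemma complex_chart_star:
  assumes "v \<in> V" shows "complex_chart (top_of_set polyhedron) (star v, chart v)"
proof -
  have "homeomorphic_maps (top_of_set (star v)) (top_of_set disc) (chart v) (unchart v)"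
    using homeomorphism_chart[OF assms] 
    by (auto simp: homeomorphic_maps_def homeomorphism_def)
  moreover have "subtopology (top_of_set polyhedron) (star v) = top_of_set (star v)"
    using star_subset by (simp add: subtopology_subtopology Int_absorb1)
  moreover have "open disc" unfolding disc_def by (rule open_gauge_less_1)
  ultimately show ?thesis
    unfolding complex_chart_def using openin_star chart_image[OF assms] 
    by (auto simp: homeomorphic_map_maps)
qed

text \<open>Two stars meet only if their centres coincide or are adjacent; in the latter case the positions
  \<open>k\<close> and \<open>k'\<close> in the links are the same for all points of the overlap.\<close>

lemma transition_holomorphic:
  assumes "v \<in> V" "v' \<in> V"
  shows "(chart v' \<circ> unchart v) holomorphic_on {w \<in> disc. unchart v w \<in> star v'}"
proof (cases "v = v'")
  case True
  have "(\<lambda>w. w) holomorphic_on {w \<in> disc. unchart v w \<in> star v'}" by (rule holomorphic_on_ident)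
  then show ?thesis
    by (rule holomorphic_transform) (use True assms chart_unchart in auto)
next
  case False
  have meet: "wt v w = wt v' (chart v' (unchart v w))" "chart v' (unchart v w) \<in> disc"
    if w: "w \<in> disc" "unchart v w \<in> star v'" for w
  proof -
    show d: "chart v' (unchart v w) \<in> disc" using w chart_in_disc assms by blast
    have "point (wt v w) = point (wt v' (chart v' (unchart v w)))"
      using unchart_chart[OF assms(2) w(2)] unfolding unchart_def by simp
    then show "wt v w = wt v' (chart v' (unchart v w))"
      using w d assms unfolding disc_def by (intro point_inj wt_in_weights) auto
  qed
  show ?thesis
  proof (cases "\<exists>k. v' = link v k")
    case True
    then obtain k where k: "v' = link v k" by blast
    obtain k' where k': "v = link v' k'" using link_sym[OF assms(1)] k by metis
    have tr: "chart v' (unchart v w) = transition k k' w" "w * rot d (- k) \<notin> \<real>\<^sub>\<le>\<^sub>0"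
      "1 - (w * rot d (- k)) powr of_real (real d / 6) \<notin> \<real>\<^sub>\<le>\<^sub>0"
      if w: "w \<in> disc" "unchart v w \<in> star v'" for w
      using wt_transition[OF assms(1) k k' meet(1)[OF w]] meet(2)[OF w] w(1) unfolding disc_def by auto
    have "transition k k' holomorphic_on {w \<in> disc. unchart v w \<in> star v'}"
      unfolding transition_def using tr(2,3) by (intro holomorphic_intros) auto
    then show ?thesis
      by (rule holomorphic_transform) (use tr(1) in auto)
  next
    case nk: False
    have "\<not> (w \<in> disc \<and> unchart v w \<in> star v')" for w
    proof
      assume w: "w \<in> disc \<and> unchart v w \<in> star v'"
      then have "wt v w v' = 1 - gauge (chart v' (unchart v w))"
        using meet(1) by simp
      then have "wt v w v' > 0" using w meet(2) unfolding disc_def by simp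
      moreover have "wt v w v' = 0"
        using nk False by (intro wt_off[OF assms(1)]) auto
      ultimately show False by simp
    qed
    then have "{w \<in> disc. unchart v w \<in> star v'} = {}" by blast
    then show ?thesis by (simp only: holomorphic_on_empty)
  qed
qed

lemma star_cover: "(\<Union>v\<in>V. star v) = polyhedron"
proof -
  have "\<exists>v\<in>V. 0 < t v" if "t \<in> weights" for t
  proof (rule ccontr)
    assume "\<not> ?thesis"
    then have "t v = 0" if "v \<in> V" for v using that weights_nonneg[OF \<open>t \<in> weights\<close>, of v] by force
    then show False using that by (simp add: weights_def)
  qed
  then show ?thesis unfolding star_def polyhedron_def by blast
qed

lemma chart_overlap:
  assumes "v \<in> V" shows "chart v ` (star v \<inter> A) = {w \<in> disc. unchart v w \<in> A}"
proof (intro equalityI subsetI)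
  fix w assume "w \<in> chart v ` (star v \<inter> A)"
  then show "w \<in> {w \<in> disc. unchart v w \<in> A}"
    using assms chart_in_disc unchart_chart by auto
next
  fix w assume "w \<in> {w \<in> disc. unchart v w \<in> A}"
  then show "w \<in> chart v ` (star v \<inter> A)"
    using assms unchart_disc chart_unchart by (intro image_eqI[of _ _ "unchart v w"]) auto
qed

theorem riemann_surface_polyhedron: "riemann_surface (top_of_set polyhedron) atlas"
proof -
  have "complex_atlas (top_of_set polyhedron) atlas"
    unfolding complex_atlas_def
  proof (intro conjI)
    show "\<forall>c\<in>atlas. complex_chart (top_of_set polyhedron) c"
      unfolding atlas_def using complex_chart_star by blast
    show "(\<Union>(U, f)\<in>atlas. U) = topspace (top_of_set polyhedron)"
      unfolding atlas_def using star_cover by simp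
    have "(chart v' \<circ> inv_into (star v) (chart v)) holomorphic_on chart v ` (star v \<inter> star v')"
      if "v \<in> V" "v' \<in> V" for v v'
      unfolding chart_overlap[OF that(1)]
      by (rule holomorphic_transform[OF transition_holomorphic[OF that]])
        (use that inv_into_chart in auto)
    then show "\<forall>(U, f)\<in>atlas. \<forall>(W, h)\<in>atlas. (h \<circ> inv_into U f) holomorphic_on f ` (U \<inter> W)"
      unfolding atlas_def by auto
  qed
  moreover have "polyhedron \<noteq> {}" using V_nonempty vertex_in_polyhedron by blast
  ultimately show ?thesis
    unfolding riemann_surface_def
    using connected_polyhedron by (auto simp: connected_space_subtopology Hausdorff_space_subtopology)
qed

lemma compact_space_polyhedron: "compact_space (top_of_set polyhedron)"
  using compact_polyhedron by (simp add: compact_space_subtopology)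

end

section \<open>Automorphisms of the triangulation\<close>

context oriented_triangulation
begin

definition triangulation_aut :: "('v \<Rightarrow> 'v) \<Rightarrow> bool" where
  "triangulation_aut \<sigma> \<longleftrightarrow> bij_betw \<sigma> V V \<and>
     (\<forall>a\<in>V. \<forall>b\<in>V. \<forall>c\<in>V. (\<sigma> a, \<sigma> b, \<sigma> c) \<in> T \<longleftrightarrow> (a, b, c) \<in> T)"

lemma triangulation_aut_bij: "triangulation_aut \<sigma> \<Longrightarrow> bij_betw \<sigma> V V"
  by (simp add: triangulation_aut_def)

lemma triangulation_aut_V: "triangulation_aut \<sigma> \<Longrightarrow> v \<in> V \<Longrightarrow> \<sigma> v \<in> V"
  using triangulation_aut_bij bij_betwE by blast

lemma triangulation_aut_T: "triangulation_aut \<sigma> \<Longrightarrow> (a, b, c) \<in> T \<Longrightarrow> (\<sigma> a, \<sigma> b, \<sigma> c) \<in> T"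
  unfolding triangulation_aut_def using T_vertices[of a b c] by blast

lemma triangulation_aut_inv:
  assumes "triangulation_aut \<sigma>" shows "triangulation_aut (inv_into V \<sigma>)"
proof -
  have b: "bij_betw \<sigma> V V" by (rule triangulation_aut_bij[OF assms])
  have "\<sigma> (inv_into V \<sigma> a) = a" "inv_into V \<sigma> a \<in> V" if "a \<in> V" for a
    using b that bij_betw_inv_into_right bij_betw_inv_into bij_betwE by metis+
  then show ?thesis
    using assms bij_betw_inv_into[OF b] unfolding triangulation_aut_def by metis
qed

text \<open>An automorphism maps triangles at \<open>v\<close> to triangles at \<open>\<sigma> v\<close> preserving orientation, so it
  can only shift the link.\<close>

lemma triangulation_aut_link:
  assumes "triangulation_aut \<sigma>" "v \<in> V"
  obtains c where "\<And>k. \<sigma> (link v k) = link (\<sigma> v) (k + c)"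
proof -
  have sv: "\<sigma> v \<in> V" using assms triangulation_aut_V by blast
  have tri: "(\<sigma> v, \<sigma> (link v k), \<sigma> (link v (k + 1))) \<in> T" for k
    using triangulation_aut_T[OF assms(1) link_T[OF assms(2)]] .
  obtain c where c: "\<sigma> (link v 0) = link (\<sigma> v) c"
    using tri[of 0] T_iff_link[OF sv] by blast
  have nat: "\<sigma> (link v (int n)) = link (\<sigma> v) (int n + c)" for n
  proof (induction n)
    case 0
    then show ?case using c by simp
  next
    case (Suc n)
    obtain k where k: "\<sigma> (link v (int n)) = link (\<sigma> v) k" "\<sigma> (link v (int n + 1)) = link (\<sigma> v) (k + 1)"
      using tri[of "int n"] T_iff_link[OF sv] by blast
    then have "int d dvd k - (int n + c)"
      using Suc link_eq_iff[OF sv] by metis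
    then have "link (\<sigma> v) (k + 1) = link (\<sigma> v) (int n + 1 + c)"
      using link_eq_iff[OF sv] by (simp add: algebra_simps)
    then show ?case using k by (simp add: algebra_simps)
  qed
  have "\<sigma> (link v k) = link (\<sigma> v) (k + c)" for k
  proof -
    have "0 \<le> k mod int d" using d_pos by simp
    then have "\<sigma> (link v (k mod int d)) = link (\<sigma> v) (k mod int d + c)"
      using nat[of "nat (k mod int d)"] by simp
    moreover have "link (\<sigma> v) (k mod int d + c) = link (\<sigma> v) (k + c)"
      using link_mod[OF sv] by (metis mod_add_left_eq)
    ultimately show ?thesis using link_mod[OF assms(2)] by simp
  qed
  then show ?thesis using that by blast
qed

definition push :: "('v \<Rightarrow> 'v) \<Rightarrow> ('v \<Rightarrow> real) \<Rightarrow> 'v \<Rightarrow> real" where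
  "push \<sigma> t u = (if u \<in> V then t (inv_into V \<sigma> u) else 0)"

lemma push_apply: "triangulation_aut \<sigma> \<Longrightarrow> v \<in> V \<Longrightarrow> push \<sigma> t (\<sigma> v) = t v"
  using triangulation_aut_V[of \<sigma> v] bij_betw_inv_into_left[OF triangulation_aut_bij, of \<sigma> v] by (simp add: push_def)

lemma push_weights:
  assumes "triangulation_aut \<sigma>" "t \<in> weights" shows "push \<sigma> t \<in> weights"
proof -
  note b = triangulation_aut_bij[OF assms(1)]
  have "sum (push \<sigma> t) V = sum (\<lambda>v. push \<sigma> t (\<sigma> v)) V"
    by (rule sum.reindex_bij_betw[OF b, symmetric])
  also have "\<dots> = 1"
    using assms push_apply by (simp add: weights_def)
  finally have "sum (push \<sigma> t) V = 1" .
  moreover have "{u. push \<sigma> t u \<noteq> 0} \<in> simplices"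
  proof -
    obtain x y z where T: "(x, y, z) \<in> T" "{v. t v \<noteq> 0} \<subseteq> {x, y, z}"
      using assms(2) unfolding weights_def simplices_def by blast
    have "{u. push \<sigma> t u \<noteq> 0} \<subseteq> {\<sigma> x, \<sigma> y, \<sigma> z}"
    proof
      fix u assume u: "u \<in> {u. push \<sigma> t u \<noteq> 0}"
      then have "u \<in> V" by (auto simp: push_def split: if_splits)
      then obtain v where "v \<in> V" "u = \<sigma> v" using b unfolding bij_betw_def by blast
      then show "u \<in> {\<sigma> x, \<sigma> y, \<sigma> z}" using u push_apply[OF assms(1)] T(2) by auto
    qed
    then show ?thesis
      using triangulation_aut_T[OF assms(1) T(1)] unfolding simplices_def by blast
  qed
  moreover have "0 \<le> push \<sigma> t u" for u
    using assms(2) by (simp add: push_def weights_def)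
  ultimately show ?thesis unfolding weights_def by blast
qed

text \<open>In the charts an automorphism is a rotation.\<close>

lemma push_wt:
  assumes "triangulation_aut \<sigma>" "v \<in> V" "gauge w \<le> 1" "\<And>k. \<sigma> (link v k) = link (\<sigma> v) (k + c)"
  shows "wt (\<sigma> v) (w * rot d c) = push \<sigma> (wt v w)"
proof (rule weights_wtI)
  show "\<sigma> v \<in> V" using assms triangulation_aut_V by blast
  show "push \<sigma> (wt v w) \<in> weights"
    using push_weights wt_in_weights assms by blast
  fix j
  have "push \<sigma> (wt v w) (link (\<sigma> v) j) = push \<sigma> (wt v w) (\<sigma> (link v (j - c)))"
    using assms(4)[of "j - c"] by simp
  also have "\<dots> = hat d (w * rot d (- (j - c)))"
    using push_apply[OF assms(1)] link_in_V wt_link assms(2) by simp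
  also have "w * rot d (- (j - c)) = w * rot d c * rot d (- j)"
    by (simp add: mult.assoc flip: rot_add)
  finally show "push \<sigma> (wt v w) (link (\<sigma> v) j) = hat d (w * rot d c * rot d (- j))" .
next
  fix u assume u: "u \<noteq> \<sigma> v" "u \<notin> range (link (\<sigma> v))"
  show "push \<sigma> (wt v w) u = 0"
  proof (cases "u \<in> V")
    case True
    then obtain x where x: "x \<in> V" "u = \<sigma> x"
      using triangulation_aut_bij[OF assms(1)] unfolding bij_betw_def by blast
    then have "x \<noteq> v" "x \<notin> range (link v)" using u assms(4) by auto
    then show ?thesis using push_apply[OF assms(1)] x wt_off[OF assms(2)] by simp
  qed (simp add: push_def)
qed

end

context geometric_triangulation
begin

text \<open>Meaningful for points of the polyhedron only, where the weights are unique.\<close>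

definition weights_of :: "'e \<Rightarrow> 'v \<Rightarrow> real" where
  "weights_of x = (THE t. t \<in> weights \<and> point t = x)"

lemma weights_of_point [simp]: "t \<in> weights \<Longrightarrow> weights_of (point t) = t"
  unfolding weights_of_def using point_inj by blast

definition pl_map :: "('v \<Rightarrow> 'v) \<Rightarrow> 'e \<Rightarrow> 'e" where
  "pl_map \<sigma> x = (\<Sum>v\<in>V. weights_of x v *\<^sub>R P (\<sigma> v))"

lemma pl_map_point:
  assumes "triangulation_aut \<sigma>" "t \<in> weights" shows "pl_map \<sigma> (point t) = point (push \<sigma> t)"
proof -
  have "point (push \<sigma> t) = (\<Sum>v\<in>V. push \<sigma> t (\<sigma> v) *\<^sub>R P (\<sigma> v))"
    unfolding point_def by (rule sum.reindex_bij_betw[OF triangulation_aut_bij[OF assms(1)], symmetric])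
  then show ?thesis
    using assms push_apply by (simp add: pl_map_def)
qed

lemma pl_map_in: "triangulation_aut \<sigma> \<Longrightarrow> x \<in> polyhedron \<Longrightarrow> pl_map \<sigma> x \<in> polyhedron"
  unfolding polyhedron_def using pl_map_point push_weights by auto

lemma pl_map_comp:
  assumes "triangulation_aut \<sigma>" "triangulation_aut \<tau>" "x \<in> polyhedron"
  shows "pl_map (\<sigma> \<circ> \<tau>) x = pl_map \<sigma> (pl_map \<tau> x)"
proof -
  obtain t where t: "t \<in> weights" "x = point t" using assms(3) unfolding polyhedron_def by blast
  have "pl_map \<sigma> (pl_map \<tau> x) = (\<Sum>v\<in>V. push \<tau> t v *\<^sub>R P (\<sigma> v))"
  proof -
    have "pl_map \<tau> x = point (push \<tau> t)" using t pl_map_point[OF assms(2)] by simp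
    then show ?thesis using push_weights[OF assms(2) t(1)] by (simp add: pl_map_def)
  qed
  also have "\<dots> = (\<Sum>v\<in>V. push \<tau> t (\<tau> v) *\<^sub>R P (\<sigma> (\<tau> v)))"
    by (rule sum.reindex_bij_betw[OF triangulation_aut_bij[OF assms(2)], symmetric])
  also have "\<dots> = pl_map (\<sigma> \<circ> \<tau>) x"
    using assms t push_apply by (simp add: pl_map_def)
  finally show ?thesis by simp
qed

lemma pl_map_cong: "(\<And>v. v \<in> V \<Longrightarrow> \<sigma> v = \<tau> v) \<Longrightarrow> pl_map \<sigma> x = pl_map \<tau> x"
  by (simp add: pl_map_def)

lemma pl_map_id: "x \<in> polyhedron \<Longrightarrow> pl_map id x = x"
  unfolding polyhedron_def by (auto simp: pl_map_def point_def[symmetric])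

lemma pl_map_vertex:
  assumes "v \<in> V" shows "pl_map \<sigma> (P v) = P (\<sigma> v)"
proof -
  define t where "t u = (if u = v then 1 else 0 :: real)" for u
  have "{u. t u \<noteq> 0} = {v}" by (simp add: t_def)
  then have "t \<in> weights"
    using assms finite_V link_simplex[OF assms, of "{v}" 0] by (simp add: weights_def t_def)
  have sum: "(\<Sum>u\<in>V. t u *\<^sub>R f u) = f v" for f :: "'v \<Rightarrow> 'e"
  proof -
    have "(\<Sum>u\<in>V. t u *\<^sub>R f u) = (\<Sum>u\<in>V. if u = v then f u else 0)"
      by (intro sum.cong) (auto simp: t_def)
    then show ?thesis using assms finite_V by simp
  qed
  have "P v = point t"
    unfolding point_def by (rule sum[symmetric])
  then show ?thesis
    using \<open>t \<in> weights\<close> sum by (simp add: pl_map_def)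
qed

lemma pl_map_inverse:
  assumes "triangulation_aut \<sigma>" "x \<in> polyhedron"
  shows "pl_map (inv_into V \<sigma>) (pl_map \<sigma> x) = x" "pl_map \<sigma> (pl_map (inv_into V \<sigma>) x) = x"
proof -
  note b = triangulation_aut_bij[OF assms(1)]
  note i = triangulation_aut_inv[OF assms(1)]
  show "pl_map (inv_into V \<sigma>) (pl_map \<sigma> x) = x"
    using pl_map_comp[OF i assms(1) assms(2)] pl_map_cong[of "inv_into V \<sigma> \<circ> \<sigma>" id x]
      bij_betw_inv_into_left[OF b] pl_map_id[OF assms(2)] by simp
  show "pl_map \<sigma> (pl_map (inv_into V \<sigma>) x) = x"
    using pl_map_comp[OF assms(1) i assms(2)] pl_map_cong[of "\<sigma> \<circ> inv_into V \<sigma>" id x]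
      bij_betw_inv_into_right[OF b] pl_map_id[OF assms(2)] by simp
qed

lemma pl_map_unchart:
  assumes "triangulation_aut \<sigma>" "v \<in> V" "\<And>k. \<sigma> (link v k) = link (\<sigma> v) (k + c)" "w \<in> disc"
  shows "pl_map \<sigma> (unchart v w) = unchart (\<sigma> v) (w * rot d c)" "w * rot d c \<in> disc"
proof -
  have w: "gauge w < 1" using assms(4) by (simp add: disc_def)
  have eq: "wt (\<sigma> v) (w * rot d c) = push \<sigma> (wt v w)"
    using push_wt[OF assms(1,2) _ assms(3)] w by simp
  show "pl_map \<sigma> (unchart v w) = unchart (\<sigma> v) (w * rot d c)"
    using w assms(1,2) eq by (simp add: unchart_def pl_map_point wt_in_weights)
  have "wt (\<sigma> v) (w * rot d c) (\<sigma> v) = wt v w v"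
    unfolding eq using push_apply assms by blast
  then show "w * rot d c \<in> disc" using w by (simp add: disc_def)
qed

lemma pl_map_holomorphic:
  assumes \<sigma>: "triangulation_aut \<sigma>" and \<phi>: "\<And>x. x \<in> polyhedron \<Longrightarrow> \<phi> x = pl_map \<sigma> x"
  shows "holomorphic_map (top_of_set polyhedron) atlas (top_of_set polyhedron) atlas \<phi>"
  unfolding holomorphic_map_def
proof
  have "continuous_on (star v) \<phi>" if v: "v \<in> V" for v
  proof -
    obtain c where c: "\<And>k. \<sigma> (link v k) = link (\<sigma> v) (k + c)"
      using triangulation_aut_link[OF \<sigma> v] by blast
    have "continuous_on (star v) (chart v)"
      using homeomorphism_chart[OF v] by (simp add: homeomorphism_def)
    then have "continuous_on (star v) (\<lambda>x. unchart (\<sigma> v) (chart v x * rot d c))"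
      by (intro continuous_on_compose2[OF continuous_on_unchart[of UNIV]] continuous_intros) auto
    moreover have "\<phi> x = unchart (\<sigma> v) (chart v x * rot d c)" if x: "x \<in> star v" for x
      using pl_map_unchart(1)[OF \<sigma> v c chart_in_disc[OF v x]] unchart_chart[OF v x] \<phi> star_subset[of v] x by auto
    ultimately show ?thesis by (simp cong: continuous_on_cong)
  qed
  then have loc: "continuous_map (subtopology (top_of_set polyhedron) (star v)) euclidean \<phi>" if "v \<in> V" for v
    using that star_subset by (simp add: subtopology_subtopology Int_absorb1)
  have "continuous_map (top_of_set polyhedron) euclidean \<phi>"
  proof (rule pasting_lemma[where I = V and T = star and f = "\<lambda>v. \<phi>"])
    show "\<exists>v. v \<in> V \<and> x \<in> star v \<and> \<phi> x = \<phi> x" if "x \<in> topspace (top_of_set polyhedron)" for x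
      using that star_cover by (metis UN_E topspace_euclidean_subtopology)
  qed (use openin_star loc in auto)
  moreover have "\<phi> \<in> polyhedron \<rightarrow> polyhedron"
    using \<phi> pl_map_in[OF \<sigma>] by (intro Pi_I) simp
  ultimately show "continuous_map (top_of_set polyhedron) (top_of_set polyhedron) \<phi>"
    by (simp add: continuous_map_in_subtopology image_subset_iff_funcset)
next
  have "(chart v' \<circ> \<phi> \<circ> inv_into (star v) (chart v)) holomorphic_on chart v ` (star v \<inter> \<phi> -` star v')"
    if v: "v \<in> V" "v' \<in> V" for v v'
  proof -
    obtain c where c: "\<And>k. \<sigma> (link v k) = link (\<sigma> v) (k + c)"
      using triangulation_aut_link[OF \<sigma> v(1)] by blast
    have sv: "\<sigma> v \<in> V" using \<sigma> v triangulation_aut_V by blast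
    have un: "unchart v w \<in> polyhedron" if "w \<in> disc" for w
      using that unchart_disc[OF v(1)] star_subset by blast
    note pm = pl_map_unchart[OF \<sigma> v(1) c]
    have "((chart v' \<circ> unchart (\<sigma> v)) \<circ> (\<lambda>w. w * rot d c)) holomorphic_on chart v ` (star v \<inter> \<phi> -` star v')"
      unfolding chart_overlap[OF v(1)]
    proof (rule holomorphic_on_compose_gen[OF _ transition_holomorphic[OF sv v(2)]])
      show "(\<lambda>w. w * rot d c) holomorphic_on {w \<in> disc. unchart v w \<in> \<phi> -` star v'}"
        by (intro holomorphic_intros)
      show "(\<lambda>w. w * rot d c) ` {w \<in> disc. unchart v w \<in> \<phi> -` star v'} \<subseteq> {w \<in> disc. unchart (\<sigma> v) w \<in> star v'}"
        using pm \<phi> un by auto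
    qed
    then show ?thesis
      by (rule holomorphic_transform) (use pm \<phi> un v in \<open>auto simp: inv_into_chart chart_overlap\<close>)
  qed
  then show "\<forall>(U, f)\<in>atlas. \<forall>(W, h)\<in>atlas. (h \<circ> \<phi> \<circ> inv_into U f) holomorphic_on f ` (U \<inter> \<phi> -` W)"
    unfolding atlas_def by auto
qed

definition surface_aut :: "('v \<Rightarrow> 'v) \<Rightarrow> 'e \<Rightarrow> 'e" where
  "surface_aut \<sigma> = restrict (pl_map \<sigma>) polyhedron"

lemma surface_aut_Bij:
  assumes "triangulation_aut \<sigma>" shows "surface_aut \<sigma> \<in> Bij polyhedron"
proof -
  have "bij_betw (pl_map \<sigma>) polyhedron polyhedron"
    by (rule bij_betw_byWitness[where f' = "pl_map (inv_into V \<sigma>)"])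
      (use pl_map_inverse[OF assms] pl_map_in assms triangulation_aut_inv[OF assms] in auto)
  then show ?thesis
    unfolding Bij_def surface_aut_def by (simp cong: bij_betw_cong)
qed

lemma surface_aut_Aut:
  assumes "triangulation_aut \<sigma>"
  shows "surface_aut \<sigma> \<in> carrier (Aut (top_of_set polyhedron) atlas)"
proof -
  have "inv_into polyhedron (surface_aut \<sigma>) x = pl_map (inv_into V \<sigma>) x" if "x \<in> polyhedron" for x
    using surface_aut_Bij[OF assms] pl_map_inverse[OF assms that] that
      pl_map_in[OF triangulation_aut_inv[OF assms] that]
    by (intro inv_into_f_eq) (auto simp: Bij_def bij_betw_def surface_aut_def)
  then show ?thesis
    using surface_aut_Bij[OF assms] pl_map_holomorphic[OF assms] pl_map_holomorphic[OF triangulation_aut_inv[OF assms]]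
    by (simp add: Aut_def surface_aut_def)
qed

lemma surface_aut_mult:
  assumes "triangulation_aut \<sigma>" "triangulation_aut \<tau>"
  shows "surface_aut (\<sigma> \<circ> \<tau>) = surface_aut \<sigma> \<otimes>\<^bsub>Aut (top_of_set polyhedron) atlas\<^esub> surface_aut \<tau>"
proof -
  have "surface_aut \<sigma> \<otimes>\<^bsub>Aut (top_of_set polyhedron) atlas\<^esub> surface_aut \<tau> = 
      compose polyhedron (surface_aut \<sigma>) (surface_aut \<tau>)"
    using surface_aut_Bij assms by (simp add: Aut_def BijGroup_def)
  also have "\<dots> = surface_aut (\<sigma> \<circ> \<tau>)"
    using pl_map_comp[OF assms] pl_map_in[OF assms(2)] by (auto simp: compose_def surface_aut_def restrict_def)
  finally show ?thesis by simp
qed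

lemma surface_aut_eqD:
  assumes "surface_aut \<sigma> = surface_aut \<tau>" "v \<in> V" "\<sigma> v \<in> V" "\<tau> v \<in> V"
  shows "\<sigma> v = \<tau> v"
proof -
  have "P (\<sigma> v) = P (\<tau> v)"
    using fun_cong[OF assms(1), of "P v"] vertex_in_polyhedron pl_map_vertex assms(2)
    by (simp add: surface_aut_def)
  then show ?thesis using inj_P assms by (simp add: inj_on_eq_iff)
qed

end

section \<open>Euler characteristic and genus\<close>

context oriented_triangulation
begin

lemma simplices_at_vertex_card:
  assumes "v \<in> V"
  shows "card {s \<in> simplices. card s = 2 \<and> v \<in> s} = d"
    and "card {s \<in> simplices. card s = 3 \<and> v \<in> s} = d"
    and "{v} \<in> simplices"
proof -
  note ne = link_neq[OF assms] link_neq[OF assms, symmetric]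
  have next_ne: "link v k \<noteq> link v (k + 1)" for k
    using link_eq_iff[OF assms] degree_ge_3 by (auto dest: zdvd_imp_le)
  have small: "j = k" if "0 \<le> j" "j < int d" "0 \<le> k" "k < int d" "link v j = link v k" for j k
    using that link_eq_iff[OF assms] by (metis mod_eq_dvd_iff mod_pos_pos_trivial)
  have sub: "\<exists>k \<in> {0..<int d}. s \<subseteq> {v, link v k, link v (k + 1)}" if s: "s \<in> simplices" "v \<in> s" for s
  proof -
    obtain k where k: "s \<subseteq> {v, link v k, link v (k + 1)}" using simplex_at_vertex[OF s] by blast
    have "link v (k mod int d + 1) = link v (k + 1)"
      using link_mod[OF assms] by (metis mod_add_left_eq)
    then show ?thesis
      using k link_mod[OF assms, of k] d_pos by (intro bexI[of _ "k mod int d"]) auto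
  qed
  have "bij_betw (\<lambda>k. {v, link v k}) {0..<int d} {s \<in> simplices. card s = 2 \<and> v \<in> s}"
    unfolding bij_betw_def
  proof (intro conjI equalityI subsetI)
    show "inj_on (\<lambda>k. {v, link v k}) {0..<int d}"
      using small ne by (intro inj_onI) (auto simp: doubleton_eq_iff)
    fix s assume "s \<in> (\<lambda>k. {v, link v k}) ` {0..<int d}"
    then obtain k where "s = {v, link v k}" by blast
    then show "s \<in> {s \<in> simplices. card s = 2 \<and> v \<in> s}"
      using ne link_simplex[OF assms, of s k] by auto
  next
    fix s assume s: "s \<in> {s \<in> simplices. card s = 2 \<and> v \<in> s}"
    then obtain u where u: "s = {v, u}" "u \<noteq> v" by (auto simp: card_2_iff)
    then obtain k where k: "k \<in> {0..<int d}" "u = link v k \<or> u = link v (k + 1)"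
      using sub[of s] s by auto
    then obtain j where "u = link v j" by blast
    then have "s = {v, link v (j mod int d)}" "j mod int d \<in> {0..<int d}"
      using u link_mod[OF assms] d_pos by auto
    then show "s \<in> (\<lambda>k. {v, link v k}) ` {0..<int d}" by blast
  qed
  from bij_betw_same_card[OF this] show "card {s \<in> simplices. card s = 2 \<and> v \<in> s} = d" by simp
  have "bij_betw (\<lambda>k. {v, link v k, link v (k + 1)}) {0..<int d} {s \<in> simplices. card s = 3 \<and> v \<in> s}"
    unfolding bij_betw_def
  proof (intro conjI equalityI subsetI)
    show "inj_on (\<lambda>k. {v, link v k, link v (k + 1)}) {0..<int d}"
    proof (rule inj_onI)
      fix j k assume jk: "j \<in> {0..<int d}" "k \<in> {0..<int d}"
        and eq: "{v, link v j, link v (j + 1)} = {v, link v k, link v (k + 1)}"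
      from eq have "{link v j, link v (j + 1)} = {link v k, link v (k + 1)}"
        using ne by (metis insert_ident insertE singletonD)
      then consider "link v j = link v k" | "link v j = link v (k + 1)" "link v (j + 1) = link v k"
        by (auto simp: doubleton_eq_iff)
      then show "j = k"
      proof cases
        case 1
        then show ?thesis using small jk by auto
      next
        case 2
        then have "int d dvd (j - (k + 1)) - (j + 1 - k)"
          using link_eq_iff[OF assms] dvd_diff by blast
        then show ?thesis using degree_ge_3 by (auto dest!: zdvd_imp_le simp: dvd_minus_iff)
      qed
    qed
    fix s assume "s \<in> (\<lambda>k. {v, link v k, link v (k + 1)}) ` {0..<int d}"
    then obtain k where "s = {v, link v k, link v (k + 1)}" by blast
    then show "s \<in> {s \<in> simplices. card s = 3 \<and> v \<in> s}"
      using ne next_ne link_simplex[OF assms, of s k] by auto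
  next
    fix s assume s: "s \<in> {s \<in> simplices. card s = 3 \<and> v \<in> s}"
    then obtain k where k: "k \<in> {0..<int d}" "s \<subseteq> {v, link v k, link v (k + 1)}"
      using sub[of s] by auto
    moreover have "card {v, link v k, link v (k + 1)} = 3"
      using ne next_ne by simp
    ultimately have "s = {v, link v k, link v (k + 1)}"
      using s by (intro card_subset_eq) auto
    then show "s \<in> (\<lambda>k. {v, link v k, link v (k + 1)}) ` {0..<int d}" using k by blast
  qed
  from bij_betw_same_card[OF this] show "card {s \<in> simplices. card s = 3 \<and> v \<in> s} = d" by simp
  show "{v} \<in> simplices" using link_simplex[OF assms, of "{v}" 0] by simp
qed

text \<open>Incidences between vertices and edges, and between vertices and triangles, are counted in two
  ways.\<close>

lemma simplex_counts:
  shows "card {s \<in> simplices. card s = 1} = card V"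
    and "2 * card {s \<in> simplices. card s = 2} = d * card V"
    and "3 * card {s \<in> simplices. card s = 3} = d * card V"
proof -
  have "{s \<in> simplices. card s = 1} = (\<lambda>v. {v}) ` V"
  proof (intro equalityI subsetI)
    fix s assume "s \<in> {s \<in> simplices. card s = 1}"
    then obtain v where "s = {v}" "{v} \<in> simplices" by (auto simp: card_1_singleton_iff)
    then show "s \<in> (\<lambda>v. {v}) ` V" using simplex_subset_V by blast
  next
    fix s assume "s \<in> (\<lambda>v. {v}) ` V"
    then show "s \<in> {s \<in> simplices. card s = 1}" using simplices_at_vertex_card(3) by auto
  qed
  then show "card {s \<in> simplices. card s = 1} = card V"
    by (simp add: card_image)
  have count: "n * card {s \<in> simplices. card s = n} = d * card V"
    if n: "\<And>v. v \<in> V \<Longrightarrow> card {s \<in> simplices. card s = n \<and> v \<in> s} = d" for n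
  proof -
    have "(\<Sum>s\<in>{s \<in> simplices. card s = n}. card {v \<in> V. v \<in> s}) = d * card V"
    proof (rule sum_multicount)
      have "{s \<in> {s \<in> simplices. card s = n}. v \<in> s} = {s \<in> simplices. card s = n \<and> v \<in> s}" for v
        by blast
      then show "\<forall>v\<in>V. card {s \<in> {s \<in> simplices. card s = n}. v \<in> s} = d"
        using n by simp
    qed (use finite_V finite_simplices in auto)
    moreover have "{v \<in> V. v \<in> s} = s" if "s \<in> simplices" for s
      using simplex_subset_V[OF that] by blast
    ultimately show ?thesis by (simp add: mult.commute)
  qed
  show "2 * card {s \<in> simplices. card s = 2} = d * card V"
    using count simplices_at_vertex_card(1) by blast
  show "3 * card {s \<in> simplices. card s = 3} = d * card V"
    using count simplices_at_vertex_card(2) by blast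
qed

end

context geometric_triangulation
begin

definition hulls :: "'e set set" where
  "hulls = (\<lambda>s. convex hull (P ` s)) ` simplices"

lemma simplex_independent:
  assumes "s \<in> simplices" shows "\<not> affine_dependent (P ` s)"
  using simplex_subset_V[OF assms] simplex_card_le[OF assms] by (intro general_position) auto

lemma simplex_card_image: "s \<in> simplices \<Longrightarrow> card (P ` s) = card s"
  using inj_P simplex_subset_V inj_on_subset by (intro card_image) blast

lemma hull_simplex_iff:
  assumes "s \<in> simplices"
  shows "n simplex (convex hull (P ` s)) \<longleftrightarrow> int (card s) = n + 1"
proof
  assume "n simplex (convex hull (P ` s))"
  then have "aff_dim (convex hull (P ` s)) = n" by (rule aff_dim_simplex)
  then show "int (card s) = n + 1"
    using aff_dim_affine_independent[OF simplex_independent[OF assms]] simplex_card_image[OF assms]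
    by (simp add: aff_dim_convex_hull)
next
  assume "int (card s) = n + 1"
  then show "n simplex (convex hull (P ` s))"
    unfolding simplex_def using simplex_independent[OF assms] simplex_card_image[OF assms] by auto
qed

lemma hull_inj: "inj_on (\<lambda>s. convex hull (P ` s)) simplices"
proof (rule inj_onI)
  fix s s' assume s: "s \<in> simplices" "s' \<in> simplices" "convex hull (P ` s) = convex hull (P ` s')"
  have "x \<in> P ` s \<longleftrightarrow> x \<in> P ` s'" for x
    using extreme_point_of_convex_hull_affine_independent[OF simplex_independent[OF s(1)], of x]
      extreme_point_of_convex_hull_affine_independent[OF simplex_independent[OF s(2)], of x] s(3) by simp
  then have "P ` s = P ` s'" by blast
  then show "s = s'"
    using inj_on_image_eq_iff[OF inj_P] simplex_subset_V s(1,2) by simp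
qed

lemma card_hulls:
  "card {S \<in> hulls. int n simplex S} = card {s \<in> simplices. card s = Suc n}"
proof -
  have "{S \<in> hulls. int n simplex S} = (\<lambda>s. convex hull (P ` s)) ` {s \<in> simplices. card s = Suc n}"
  proof -
    have "int n simplex (convex hull (P ` s)) \<longleftrightarrow> card s = Suc n" if "s \<in> simplices" for s
      using hull_simplex_iff[OF that, of "int n"] by linarith
    then show ?thesis unfolding hulls_def by auto
  qed
  then show ?thesis
    using card_image[OF inj_on_subset[OF hull_inj]] by simp
qed

lemma simplicial_complex_hulls: "simplicial_complex hulls"
  unfolding simplicial_complex_def
proof (intro conjI ballI allI impI)
  show "finite hulls" unfolding hulls_def using finite_simplices by simp
  fix S assume "S \<in> hulls"
  then obtain s where s: "s \<in> simplices" "S = convex hull (P ` s)" unfolding hulls_def by blast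
  show "\<exists>n. n simplex S"
    using hull_simplex_iff[OF s(1), of "int (card s) - 1"] s(2) by auto
next
  fix F S assume "S \<in> hulls \<and> F face_of S"
  then obtain s where s: "s \<in> simplices" "F face_of convex hull (P ` s)" unfolding hulls_def by blast
  then obtain c where "c \<subseteq> P ` s" "F = convex hull c"
    using face_of_convex_hull_affine_independent[OF simplex_independent[OF s(1)]] by blast
  then obtain s' where "s' \<subseteq> s" "F = convex hull (P ` s')" by (auto simp: subset_image_iff)
  then show "F \<in> hulls" unfolding hulls_def using simplices_down s(1) by blast
next
  fix S S' assume "S \<in> hulls \<and> S' \<in> hulls"
  then obtain s s' where s: "s \<in> simplices" "S = convex hull (P ` s)" "s' \<in> simplices" "S' = convex hull (P ` s')"
    unfolding hulls_def by blast
  have si: "s \<inter> s' \<in> simplices" using simplices_down[OF s(1)] by blast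
  have "inj_on point weights" using point_inj by (intro inj_onI)
  then have "S \<inter> S' = point ` ({t \<in> weights. {v. t v \<noteq> 0} \<subseteq> s} \<inter> {t \<in> weights. {v. t v \<noteq> 0} \<subseteq> s'})"
    unfolding s(2,4) hull_simplex_eq[OF s(1)] hull_simplex_eq[OF s(3)]
    by (intro inj_on_image_Int[symmetric]) auto
  also have "{t \<in> weights. {v. t v \<noteq> 0} \<subseteq> s} \<inter> {t \<in> weights. {v. t v \<noteq> 0} \<subseteq> s'} = {t \<in> weights. {v. t v \<noteq> 0} \<subseteq> s \<inter> s'}"
    by blast
  finally have "S \<inter> S' = convex hull (P ` (s \<inter> s'))"
    using hull_simplex_eq[OF si] by simp
  moreover have "P ` (s \<inter> s') \<subseteq> P ` s" by blast
  ultimately show "S \<inter> S' face_of S"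
    unfolding s(2) face_of_convex_hull_affine_independent[OF simplex_independent[OF s(1)]] by metis
qed

text \<open>With \<open>V\<close> vertices there are \<open>d * V / 2\<close> edges and \<open>d * V / 3\<close> triangles.  The factor 6
  clears the denominators.\<close>

lemma euler_characteristic:
  "6 * (int (card {S \<in> hulls. 0 simplex S}) - int (card {S \<in> hulls. 1 simplex S})
      + int (card {S \<in> hulls. 2 simplex S})) = int (card V) * (6 - int d)"
proof -
  have "card {S \<in> hulls. 0 simplex S} = card V"
    using card_hulls[of 0] simplex_counts(1) by simp
  moreover have "card {S \<in> hulls. 1 simplex S} = card {s \<in> simplices. card s = 2}"
    using card_hulls[of 1] by (simp add: numeral_2_eq_2)
  moreover have "card {S \<in> hulls. 2 simplex S} = card {s \<in> simplices. card s = 3}"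
    using card_hulls[of 2] by (simp add: numeral_3_eq_3)
  moreover have "2 * int (card {s \<in> simplices. card s = 2}) = int d * int (card V)"
      "3 * int (card {s \<in> simplices. card s = 3}) = int d * int (card V)"
    using arg_cong[OF simplex_counts(2), of int] arg_cong[OF simplex_counts(3), of int] by simp_all
  ultimately show ?thesis by (simp add: algebra_simps)
qed

end

lemma has_genus_polyhedron:
  fixes P :: "'v \<Rightarrow> real ^ 5"
  assumes "geometric_triangulation V T d P" "int (card V) * (int d - 6) = 12 * (int g - 1)"
  shows "has_genus (top_of_set (geometric_triangulation.polyhedron V T P)) g"
proof -
  interpret geometric_triangulation V T d P by fact
  have "polyhedron = \<Union> hulls" unfolding polyhedron_eq_Union hulls_def by simp
  moreover have "int (card {S \<in> hulls. 0 simplex S}) - int (card {S \<in> hulls. 1 simplex S})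
      + int (card {S \<in> hulls. 2 simplex S}) = 2 - 2 * int g"
    using euler_characteristic assms(2) by (simp add: algebra_simps)
  ultimately show ?thesis
    unfolding has_genus_def using simplicial_complex_hulls
    by (intro exI[of _ hulls]) (simp add: homeomorphic_space_refl)
qed

section \<open>General position on the moment curve\<close>

definition coordinate_number :: "'n::finite \<Rightarrow> nat" where
  "coordinate_number = (SOME f. bij_betw f UNIV {0..<CARD('n)})"

lemma coordinate_number_bij: "bij_betw (coordinate_number :: 'n::finite \<Rightarrow> nat) UNIV {0..<CARD('n)}"
  unfolding coordinate_number_def by (rule someI_ex[OF ex_bij_betw_finite_nat[OF finite]])

definition moment_curve :: "real \<Rightarrow> real ^ 'n" where
  "moment_curve c = (\<chi> i. c ^ Suc (coordinate_number i))"

lemma inj_moment_curve: "inj (moment_curve :: real \<Rightarrow> real ^ 'n)"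
proof (rule injI)
  fix a b assume eq: "moment_curve a = (moment_curve b :: real ^ 'n)"
  obtain i :: 'n where "coordinate_number i = 0"
    using bij_betw_imp_surj_on[OF coordinate_number_bij[where 'n = 'n]]
    by (metis UNIV_I atLeastLessThan_iff image_iff le0 zero_less_card_finite)
  then show "a = b"
    using arg_cong[OF eq, of "\<lambda>x. x $ i"] by (simp add: moment_curve_def)
qed

text \<open>An affine relation between points of the moment curve is a combination of evaluations at their
  parameters that annihilates all polynomials of degree at most \<open>CARD('n)\<close>.  The polynomial
  vanishing at all parameters but one shows that the remaining coefficient is 0.\<close>

lemma moment_curve_affine_independent:
  assumes "finite S" "card S \<le> Suc CARD('n)"
  shows "\<not> affine_dependent ((moment_curve :: real \<Rightarrow> real ^ 'n) ` S)"
proof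
  let ?m = "moment_curve :: real \<Rightarrow> real ^ 'n"
  have inj: "inj_on ?m S" using inj_moment_curve inj_on_subset by blast
  assume "affine_dependent (?m ` S)"
  then obtain U c0 where U: "sum U (?m ` S) = 0" "(\<Sum>x\<in>?m ` S. U x *\<^sub>R x) = 0"
      and c0: "c0 \<in> S" "U (?m c0) \<noteq> 0"
    using assms(1) by (auto simp: affine_dependent_explicit_finite)
  define f where "f c = U (?m c)" for c
  have power: "(\<Sum>c\<in>S. f c * c ^ k) = 0" if "k \<le> CARD('n)" for k
  proof (cases k)
    case 0
    then show ?thesis using U(1) inj by (simp add: sum.reindex f_def)
  next
    case (Suc j)
    then have "j \<in> {0..<CARD('n)}" using that by simp
    then obtain i :: 'n where i: "coordinate_number i = j"
      using bij_betw_imp_surj_on[OF coordinate_number_bij[where 'n = 'n]] by (metis imageE)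
    have "(\<Sum>c\<in>S. f c *\<^sub>R ?m c) $ i = 0"
      using U(2) inj by (simp add: sum.reindex f_def)
    then show ?thesis
      by (simp add: sum_component moment_curve_def i Suc)
  qed
  have poly: "(\<Sum>c\<in>S. f c * poly q c) = 0" if "Polynomial.degree q \<le> CARD('n)" for q
  proof -
    have "(\<Sum>c\<in>S. f c * poly q c) = (\<Sum>c\<in>S. \<Sum>k\<le>Polynomial.degree q. Polynomial.coeff q k * (f c * c ^ k))"
      by (simp add: poly_altdef sum_distrib_left mult_ac)
    also have "\<dots> = (\<Sum>k\<le>Polynomial.degree q. Polynomial.coeff q k * (\<Sum>c\<in>S. f c * c ^ k))"
      by (subst sum.swap) (simp add: sum_distrib_left)
    also have "\<dots> = 0" using power that by simp
    finally show ?thesis .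
  qed
  define q where "q = (\<Prod>b\<in>S - {c0}. [:- b, 1:])"
  have "Polynomial.degree q = card (S - {c0})"
    unfolding q_def by (subst degree_prod_eq_sum_degree) auto
  then have "(\<Sum>c\<in>S. f c * poly q c) = 0"
    using poly assms c0(1) by (simp add: card_Diff_singleton)
  moreover have "poly q c = 0" if "c \<in> S" "c \<noteq> c0" for c
    unfolding q_def poly_prod using that assms(1) by (intro prod_zero) auto
  ultimately have "f c0 * poly q c0 = 0"
    using assms(1) c0(1) by (subst (asm) sum.remove[of S c0]) auto
  moreover have "poly q c0 \<noteq> 0"
    unfolding q_def poly_prod using assms(1) by auto
  ultimately show False using c0(2) by (simp add: f_def)
qed

lemma exists_geometric_triangulation:
  assumes "oriented_triangulation V T d"
  obtains P :: "'v \<Rightarrow> real ^ 5" where "geometric_triangulation V T d P"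
proof -
  interpret oriented_triangulation V T d by fact
  obtain e :: "'v \<Rightarrow> nat" where e: "inj_on e V"
    using finite_V finite_imp_inj_to_nat_seg by metis
  define P :: "'v \<Rightarrow> real ^ 5" where "P v = moment_curve (real (e v))" for v
  have "inj_on P V"
    using e by (auto simp: P_def inj_eq[OF inj_moment_curve] inj_on_eq_iff intro!: inj_onI)
  moreover have "\<not> affine_dependent (P ` S)" if "S \<subseteq> V" "card S \<le> 6" for S
  proof -
    have "P ` S = moment_curve ` ((\<lambda>v. real (e v)) ` S)"
      unfolding P_def by auto
    moreover have "finite S" using that finite_V finite_subset by blast
    moreover have "card ((\<lambda>v. real (e v)) ` S) \<le> 6"
      using card_image_le[OF \<open>finite S\<close>] that(2) le_trans by blast
    ultimately show ?thesis
      using moment_curve_affine_independent[where 'n = 5, of "(\<lambda>v. real (e v)) ` S"] by simp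
  qed
  ultimately have "geometric_triangulation V T d P"
    by unfold_locales auto
  then show ?thesis using that by blast
qed

section \<open>Finite quotients of the triangle group\<close>

text \<open>The type \<open>3\<close> is the ring of integers modulo 3.  It indexes the generators, which makes the
  cyclic symmetry of the triangle group available by shifting the index.\<close>

lemma mod3 [simp]:
  fixes i :: 3
  shows "i + 1 + 1 = i + 2" "i + 1 + 2 = i" "i + 2 + 1 = i" "i + 2 + 2 = i + 1"
    "i \<noteq> i + 1" "i + 1 \<noteq> i" "i \<noteq> i + 2" "i + 2 \<noteq> i" "i + 1 \<noteq> i + 2" "i + 2 \<noteq> i + 1"
  by (simp_all add: add.assoc)

lemma exhaust3: fixes i :: 3 shows "i = 0 \<or> i = 1 \<or> i = 2"
proof (cases i)
  case (of_int z)
  then have "z = 0 \<or> z = 1 \<or> z = 2" by auto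
  then show ?thesis using of_int by auto
qed

text \<open>A finite quotient of the triangle group with three periods \<open>p\<close> in which the generators keep their
  order and generate subgroups that meet trivially.\<close>

locale triangle_group = group G for G :: "('g, 'm) monoid_scheme" (structure) +
  fixes p :: nat and x :: "3 \<Rightarrow> 'g"
  assumes finite_G: "finite (carrier G)"
    and p_ge_2: "2 \<le> p"
    and x_closed [simp]: "x i \<in> carrier G"
    and x_ord: "ord (x i) = p"
    and relation: "x i \<otimes> x (i + 1) \<otimes> x (i + 2) = \<one>"
    and trivial_meet: "x i [^] (j :: int) = x (i + 1) [^] (k :: int) \<Longrightarrow> x i [^] j = \<one>"
    and generators: "generate G (range x) = carrier G"
begin

lemma x_pow_eq_one: "x i [^] (k :: int) = \<one> \<longleftrightarrow> int p dvd k"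
  using int_pow_eq_id[of "x i" k] x_ord by simp

lemma trivial_meet2: "x i [^] (j :: int) = x (i + 2) [^] (k :: int) \<Longrightarrow> x i [^] j = \<one>"
  using trivial_meet[of "i + 2" k j] by simp

definition lcos :: "3 \<Rightarrow> 'g \<Rightarrow> 'g set" where
  "lcos i g = range (\<lambda>k :: int. g \<otimes> x i [^] k)"

lemma lcos_eq_iff:
  assumes "g \<in> carrier G" "h \<in> carrier G"
  shows "lcos i g = lcos i h \<longleftrightarrow> (\<exists>k :: int. h = g \<otimes> x i [^] k)"
proof
  assume "lcos i g = lcos i h"
  moreover have "h \<otimes> x i [^] (0 :: int) \<in> lcos i h" unfolding lcos_def by blast
  ultimately show "\<exists>k :: int. h = g \<otimes> x i [^] k" using assms unfolding lcos_def by auto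
next
  assume "\<exists>k :: int. h = g \<otimes> x i [^] k"
  then obtain k :: int where k: "h = g \<otimes> x i [^] k" by blast
  have "h \<otimes> x i [^] j = g \<otimes> x i [^] (k + j)" "g \<otimes> x i [^] j = h \<otimes> x i [^] (j - k)" for j
    using assms by (simp_all add: k m_assoc int_pow_mult[symmetric])
  then show "lcos i g = lcos i h"
    unfolding lcos_def by (intro equalityI image_subsetI) (metis rangeI)+
qed

definition vx :: "3 \<Rightarrow> 'g \<Rightarrow> 3 \<times> 'g set" where
  "vx i g = (i, lcos i g)"

lemma vx_eq_iff:
  "g \<in> carrier G \<Longrightarrow> h \<in> carrier G \<Longrightarrow> vx i g = vx j h \<longleftrightarrow> i = j \<and> (\<exists>k :: int. h = g \<otimes> x i [^] k)"
  using lcos_eq_iff by (auto simp: vx_def)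

lemma vx_pow [simp]: "g \<in> carrier G \<Longrightarrow> vx i (g \<otimes> x i [^] (k :: int)) = vx i g"
  using vx_eq_iff by (metis int_pow_closed m_closed x_closed)

lemma vx_mult [simp]: "g \<in> carrier G \<Longrightarrow> vx i (g \<otimes> x i) = vx i g"
  using vx_pow[of g i 1] by (simp add: int_pow_1)

lemma vx_inv [simp]: "g \<in> carrier G \<Longrightarrow> vx i (g \<otimes> inv (x i)) = vx i g"
  using vx_pow[of g i "-1"] by (simp add: int_pow_neg int_pow_1)

text \<open>The stabilizers of the vertices of the triangle tessellation are the conjugates of the cyclic
  groups generated by the three generators, so the vertices of its quotient are their left cosets.\<close>

definition verts :: "(3 \<times> 'g set) set" where
  "verts = {vx i g | i g. g \<in> carrier G}"

lemma verts_cases: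
  assumes "v \<in> verts" obtains i g where "g \<in> carrier G" "v = vx i g"
  using assms unfolding verts_def by auto

text \<open>Each group element contributes a positive triangle formed by its three cosets, and a negative
  triangle that shares the edge of types \<open>i\<close> and \<open>i + 1\<close> with it.  Letting \<open>i\<close> vary amounts to
  rotating the triples, up to a renaming of group elements for the negative ones.\<close>

definition tris :: "((3 \<times> 'g set) \<times> (3 \<times> 'g set) \<times> (3 \<times> 'g set)) set" where
  "tris = {(vx i g, vx (i + 1) g, vx (i + 2) g) | i g. g \<in> carrier G} \<union>
     {(vx i g, vx (i + 2) (g \<otimes> inv (x i)), vx (i + 1) g) | i g. g \<in> carrier G}"

lemma tris_pos: "g \<in> carrier G \<Longrightarrow> (vx i g, vx (i + 1) g, vx (i + 2) g) \<in> tris"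
  and tris_neg: "g \<in> carrier G \<Longrightarrow> (vx i g, vx (i + 2) (g \<otimes> inv (x i)), vx (i + 1) g) \<in> tris"
  unfolding tris_def by blast+

lemma tris_cases:
  assumes "(a, b, c) \<in> tris"
  obtains (1) i g where "g \<in> carrier G" "a = vx i g" "b = vx (i + 1) g" "c = vx (i + 2) g"
    | (2) i g where "g \<in> carrier G" "a = vx i g" "b = vx (i + 2) (g \<otimes> inv (x i))" "c = vx (i + 1) g"
  using assms unfolding tris_def by auto

text \<open>For negative triangles this is where the relation between the generators enters.\<close>

lemma tris_rotate: assumes "(a, b, c) \<in> tris" shows "(b, c, a) \<in> tris"
proof -
  from assms show ?thesis
  proof (cases rule: tris_cases)
    case (1 i g)
    then show ?thesis using tris_pos[of g "i + 1"] by simp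
  next
    case (2 i g)
    have "x (i + 1) \<otimes> (x (i + 2) \<otimes> x i) = \<one>"
      using relation[of "i + 1"] by (simp add: m_assoc)
    then have "x (i + 1) = inv (x (i + 2) \<otimes> x i)"
      by (simp add: inv_equality)
    then have "inv (x i) \<otimes> inv (x (i + 2)) = x (i + 1)"
      by (simp add: inv_mult_group)
    then have "g \<otimes> inv (x i) \<otimes> inv (x (i + 2)) = g \<otimes> x (i + 1)"
      using 2 by (simp add: m_assoc)
    then show ?thesis using tris_neg[of "g \<otimes> inv (x i)" "i + 2"] 2 by simp
  qed
qed

text \<open>The link of the coset of \<open>g\<close>: going around the vertex, vertices of the two other types alternate,
  and two steps amount to multiplication by the generator that fixes the vertex.\<close>

definition cycle :: "3 \<Rightarrow> 'g \<Rightarrow> int \<Rightarrow> 3 \<times> 'g set" where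
  "cycle i g k = vx (if even k then i + 1 else i + 2) (g \<otimes> x i [^] (k div 2))"

lemma cycle_odd: "cycle i g (2 * m + 1) = vx (i + 2) (g \<otimes> x i [^] m)"
  and cycle_odd_next: "cycle i g (2 * m + 1 + 1) = vx (i + 1) (g \<otimes> x i [^] (m + 1))"
proof -
  show "cycle i g (2 * m + 1) = vx (i + 2) (g \<otimes> x i [^] m)"
    by (simp add: cycle_def)
  have "2 * m + 1 + 1 = 2 * (m + 1)" by simp
  then show "cycle i g (2 * m + 1 + 1) = vx (i + 1) (g \<otimes> x i [^] (m + 1))"
    by (simp only: cycle_def) simp
qed

text \<open>The trivial intersection of the cyclic subgroups forces the neighbours of each type to be
  distinct, so the quotient is a simplicial complex.\<close>

lemma cycle_eq_iff:
  assumes g: "g \<in> carrier G" shows "cycle i g j = cycle i g k \<longleftrightarrow> int (2 * p) dvd j - k"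
proof -
  have pw: "(\<exists>m :: int. g \<otimes> x i [^] b = g \<otimes> x i [^] a \<otimes> x l [^] m) \<longleftrightarrow> int p dvd a - b"
    if l: "l = i + 1 \<or> l = i + 2" for a b :: int and l
  proof
    assume "\<exists>m :: int. g \<otimes> x i [^] b = g \<otimes> x i [^] a \<otimes> x l [^] m"
    then obtain m :: int where "g \<otimes> x i [^] b = g \<otimes> x i [^] a \<otimes> x l [^] m" by blast
    then have "x i [^] b = x i [^] a \<otimes> x l [^] m"
      using g by (simp add: m_assoc)
    then have "inv (x i [^] a) \<otimes> x i [^] b = x l [^] m"
      by (simp add: m_assoc[symmetric])
    then have "x i [^] (b - a) = x l [^] m"
      by (metis add.commute int_pow_mult int_pow_neg uminus_add_conv_diff x_closed)
    then have "x i [^] (b - a) = \<one>"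
      using l trivial_meet trivial_meet2 by blast
    then show "int p dvd a - b" using x_pow_eq_one by (simp add: dvd_diff_commute)
  next
    assume "int p dvd a - b"
    then have "x i [^] b = x i [^] a"
      using int_pow_eq[of "x i" b a] x_ord by simp
    then have "g \<otimes> x i [^] b = g \<otimes> x i [^] a \<otimes> x l [^] (0 :: int)" using g by simp
    then show "\<exists>m :: int. g \<otimes> x i [^] b = g \<otimes> x i [^] a \<otimes> x l [^] m" by blast
  qed
  have "int (2 * p) dvd 2 * j' + r - (2 * k' + r) \<longleftrightarrow> int p dvd j' - k'" for j' k' r
  proof -
    have "2 * j' + r - (2 * k' + r) = 2 * (j' - k')" by simp
    then show ?thesis by (simp only: of_nat_mult of_nat_numeral dvd_mult_cancel_left) simp
  qed
  note dv = this[of _ 0] this[of _ 1]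
  have odd: "\<not> int (2 * p) dvd 2 * j' + 1 - 2 * k'" "\<not> int (2 * p) dvd 2 * k' - (2 * j' + 1)" for j' k'
    by (auto dest!: dvd_mult_left)+
  show ?thesis
  proof (cases "even j"; cases "even k")
    assume "even j" "even k"
    then obtain a b where "j = 2 * a" "k = 2 * b" by (auto elim!: evenE)
    then show ?thesis using g pw[of "i + 1"] dv(1)[of a b] by (simp add: cycle_def vx_eq_iff)
  next
    assume "even j" "odd k"
    then obtain a b where "j = 2 * a" "k = 2 * b + 1" by (auto elim!: evenE oddE)
    then show ?thesis using g odd by (simp add: cycle_def vx_eq_iff)
  next
    assume "odd j" "even k"
    then obtain a b where "j = 2 * a + 1" "k = 2 * b" by (auto elim!: evenE oddE)
    then show ?thesis using g odd by (simp add: cycle_def vx_eq_iff)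
  next
    assume "odd j" "odd k"
    then obtain a b where "j = 2 * a + 1" "k = 2 * b + 1" by (auto elim!: oddE)
    then show ?thesis using g pw[of "i + 2"] dv(2)[of a b] by (simp add: cycle_def vx_eq_iff)
  qed
qed

lemma tris_iff_cycle:
  assumes g: "g \<in> carrier G"
  shows "(vx i g, a, b) \<in> tris \<longleftrightarrow> (\<exists>k. a = cycle i g k \<and> b = cycle i g (k + 1))"
proof
  assume "(vx i g, a, b) \<in> tris"
  then show "\<exists>k. a = cycle i g k \<and> b = cycle i g (k + 1)"
  proof (cases rule: tris_cases)
    case (1 j h)
    then obtain m :: int where "j = i" "h = g \<otimes> x i [^] m"
      using vx_eq_iff[OF g 1(1), of i j] by auto
    then have "a = cycle i g (2 * m)" "b = cycle i g (2 * m + 1)"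
      using 1 by (simp_all add: cycle_def)
    then show ?thesis by blast
  next
    case (2 j h)
    then obtain m :: int where m: "j = i" "h = g \<otimes> x i [^] m"
      using vx_eq_iff[OF g 2(1), of i j] by auto
    have "x i [^] m \<otimes> inv (x i) = x i [^] (m - 1)"
      by (simp add: int_pow_diff int_pow_1)
    then have "a = cycle i g (2 * (m - 1) + 1)" "b = cycle i g (2 * (m - 1) + 1 + 1)"
      using 2 m g by (simp_all only: cycle_odd cycle_odd_next) (simp_all add: m_assoc)
    then show ?thesis by blast
  qed
next
  assume "\<exists>k. a = cycle i g k \<and> b = cycle i g (k + 1)"
  then obtain k where k: "a = cycle i g k" "b = cycle i g (k + 1)" by blast
  show "(vx i g, a, b) \<in> tris"
  proof (cases "even k")
    case True
    then obtain m where "k = 2 * m" by (auto elim!: evenE)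
    then show ?thesis
      using tris_pos[of "g \<otimes> x i [^] m" i] g k by (simp add: cycle_def)
  next
    case False
    then obtain m where m: "k = 2 * m + 1" by (auto elim!: oddE)
    have "x i [^] (m + 1) \<otimes> inv (x i) = x i [^] m"
      using int_pow_diff[of "x i" "m + 1" 1] by (simp add: int_pow_1)
    then show ?thesis
      using tris_neg[of "g \<otimes> x i [^] (m + 1)" i] g k m by (simp add: cycle_def m_assoc add.commute[of 1 m])
  qed
qed

text \<open>A set of vertices closed under adjacency contains, with one coset of \<open>g\<close>, all cosets of \<open>g\<close>; and
  \<open>g\<close> and \<open>g \<otimes> x i\<close> share their coset of type \<open>i\<close>.  As the generators generate, all
  vertices are reached.\<close>

lemma verts_connected:
  assumes S: "S \<subseteq> verts" "S \<noteq> {}" "\<And>a b c. (a, b, c) \<in> tris \<Longrightarrow> a \<in> S \<Longrightarrow> b \<in> S"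
  shows "S = verts"
proof -
  have next_type: "vx (i + 1) g \<in> S" if "g \<in> carrier G" "vx i g \<in> S" for i g
    using S(3) tris_pos that by blast
  have all_types: "vx j g \<in> S" if "g \<in> carrier G" "vx i g \<in> S" for i j g
  proof -
    have "vx (i + 1) g \<in> S" "vx (i + 2) g \<in> S"
      using next_type[of g i] next_type[of g "i + 1"] that by simp_all
    moreover have "j = i \<or> j = i + 1 \<or> j = i + 2"
      using exhaust3[of "j - i"] by (metis add.commute add_0 diff_add_cancel)
    ultimately show ?thesis using that by blast
  qed
  have step: "\<forall>g\<in>carrier G. (\<forall>j. vx j g \<in> S) \<longrightarrow> (\<forall>j. vx j (g \<otimes> h) \<in> S)"
    if "h \<in> generate G (range x)" for h
    using that
  proof (induction h rule: generate.induct)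
    case one
    then show ?case by simp
  next
    case (incl h)
    then obtain i where "h = x i" by blast
    then show ?case using all_types[of "_ \<otimes> x i" i] by (metis m_closed vx_mult x_closed)
  next
    case (inv h)
    then obtain i where "h = x i" by blast
    then show ?case using all_types[of "_ \<otimes> inv (x i)" i] by (metis m_closed vx_inv x_closed inv_closed)
  next
    case (eng h1 h2)
    then have "h1 \<in> carrier G" "h2 \<in> carrier G" using generators by auto
    then show ?case using eng.IH by (simp add: m_assoc[symmetric])
  qed
  obtain i0 g0 where g0: "g0 \<in> carrier G" "vx i0 g0 \<in> S"
    using S(1,2) unfolding verts_def by blast
  have "vx j g \<in> S" if "g \<in> carrier G" for j g
  proof -
    have "inv g0 \<otimes> g \<in> generate G (range x)" using that g0 generators by simp
    then have "vx j (g0 \<otimes> (inv g0 \<otimes> g)) \<in> S" using step g0 all_types[OF g0] by blast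
    then show ?thesis using that g0 by (simp add: m_assoc[symmetric])
  qed
  then show ?thesis using S(1) unfolding verts_def by blast
qed

lemma finite_verts: "finite verts"
proof -
  have "verts = (\<Union>i. vx i ` carrier G)"
    unfolding verts_def by blast
  then show ?thesis using finite_G by simp
qed

sublocale oriented_triangulation verts tris "2 * p"
proof
  show "finite verts" by (rule finite_verts)
  show "verts \<noteq> {}" unfolding verts_def by blast
  show "(b, c, a) \<in> tris" if "(a, b, c) \<in> tris" for a b c
    using that by (rule tris_rotate)
  show "a \<in> verts" if "(a, b, c) \<in> tris" for a b c
    using that by (cases rule: tris_cases) (auto simp: verts_def)
  show "a \<noteq> b" if "(a, b, c) \<in> tris" for a b c
    using that by (cases rule: tris_cases) (auto simp: vx_def)
  show "3 \<le> 2 * p" using p_ge_2 by simp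
  show "\<exists>L :: int \<Rightarrow> _. (\<forall>j k. L j = L k \<longleftrightarrow> int (2 * p) dvd j - k) \<and>
      (\<forall>a b. (v, a, b) \<in> tris \<longleftrightarrow> (\<exists>k. a = L k \<and> b = L (k + 1)))" if v: "v \<in> verts" for v
  proof -
    obtain i g where g: "g \<in> carrier G" "v = vx i g" using v by (rule verts_cases)
    show ?thesis
      unfolding g(2)
      by (intro exI[of _ "cycle i g"] conjI allI cycle_eq_iff[OF g(1)] tris_iff_cycle[OF g(1)])
  qed
  show "S = verts" if "S \<subseteq> verts" "S \<noteq> {}" "\<And>a b c. (a, b, c) \<in> tris \<Longrightarrow> a \<in> S \<Longrightarrow> b \<in> S" for S
    by (rule verts_connected[OF that])
qed

text \<open>Each element lies in three vertices and each vertex has \<open>p\<close> elements.\<close>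

lemma card_verts: "p * card verts = 3 * order G"
proof -
  have "card {g \<in> carrier G. g \<in> snd v} = p" if "v \<in> verts" for v
  proof -
    obtain i h where h: "h \<in> carrier G" "v = vx i h" using \<open>v \<in> verts\<close> unfolding verts_def by blast
    then have "{g \<in> carrier G. g \<in> snd v} = (\<lambda>u. h \<otimes> u) ` generate G {x i}"
      by (auto simp: vx_def lcos_def generate_pow)
    then have "card {g \<in> carrier G. g \<in> snd v} = card (generate G {x i})"
      using h generate_in_carrier[of "{x i}"] by (simp add: card_image inj_on_def)
    then show ?thesis using generate_pow_card[of "x i"] x_ord by simp
  qed
  then have "(\<Sum>g\<in>carrier G. card {v \<in> verts. g \<in> snd v}) = p * card verts"
    using finite_G finite_verts by (intro sum_multicount) auto
  moreover have "card {v \<in> verts. g \<in> snd v} = 3" if g: "g \<in> carrier G" for g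
  proof -
    have "{v \<in> verts. g \<in> snd v} = range (\<lambda>i. vx i g)"
    proof (intro equalityI subsetI)
      fix v assume "v \<in> {v \<in> verts. g \<in> snd v}"
      then obtain i h where h: "h \<in> carrier G" "v = vx i h" "g \<in> lcos i h"
        unfolding verts_def by (auto simp: vx_def)
      then have "vx i g = v" by (auto simp: lcos_def)
      then show "v \<in> range (\<lambda>i. vx i g)" by blast
    next
      fix v assume "v \<in> range (\<lambda>i. vx i g)"
      then obtain i where i: "v = vx i g" by blast
      have "g \<otimes> x i [^] (0 :: int) \<in> lcos i g" unfolding lcos_def by blast
      then show "v \<in> {v \<in> verts. g \<in> snd v}"
        using i g unfolding verts_def by (auto simp: vx_def)
    qed
    moreover have "inj (\<lambda>i. vx i g)" by (auto simp: inj_def vx_def)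
    ultimately show ?thesis by (simp add: card_image)
  qed
  ultimately show ?thesis by (simp add: order_def mult.commute)
qed

definition act :: "'g \<Rightarrow> 3 \<times> 'g set \<Rightarrow> 3 \<times> 'g set" where
  "act h = (\<lambda>(i, C). (i, (\<lambda>u. h \<otimes> u) ` C))"

lemma act_vx: 
  assumes "h \<in> carrier G" "g \<in> carrier G" shows "act h (vx i g) = vx i (h \<otimes> g)"
proof -
  have "(\<lambda>u. h \<otimes> u) ` lcos i g = lcos i (h \<otimes> g)"
    unfolding lcos_def image_image using assms by (simp add: m_assoc)
  then show ?thesis by (simp add: act_def vx_def)
qed

lemma act_verts: "h \<in> carrier G \<Longrightarrow> v \<in> verts \<Longrightarrow> act h v \<in> verts"
  unfolding verts_def using act_vx by fastforce

lemma act_mult: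
  "h \<in> carrier G \<Longrightarrow> h' \<in> carrier G \<Longrightarrow> v \<in> verts \<Longrightarrow> act (h \<otimes> h') v = act h (act h' v)"
  unfolding verts_def by (auto simp: act_vx m_assoc)

lemma act_one: "v \<in> verts \<Longrightarrow> act \<one> v = v"
  unfolding verts_def by (auto simp: act_vx)

lemma act_inv:
  assumes "h \<in> carrier G" "v \<in> verts"
  shows "act (inv h) (act h v) = v" "act h (act (inv h) v) = v"
  using assms act_mult[of "inv h" h v] act_mult[of h "inv h" v] act_one by simp_all

lemma act_tris: 
  assumes "h \<in> carrier G" "(a, b, c) \<in> tris" shows "(act h a, act h b, act h c) \<in> tris"
proof -
  from assms(2) show ?thesis
  proof (cases rule: tris_cases)
    case (1 i g)
    then show ?thesis using tris_pos[of "h \<otimes> g" i] assms(1) by (simp add: act_vx)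
  next
    case (2 i g)
    then show ?thesis using tris_neg[of "h \<otimes> g" i] assms(1) by (simp add: act_vx m_assoc)
  qed
qed

lemma act_aut:
  assumes "h \<in> carrier G" shows "triangulation_aut (act h)"
proof -
  have "bij_betw (act h) verts verts"
    by (rule bij_betw_byWitness[where f' = "act (inv h)"])
      (use assms act_inv act_verts in auto)
  moreover have "(a, b, c) \<in> tris" if "a \<in> verts" "b \<in> verts" "c \<in> verts" "(act h a, act h b, act h c) \<in> tris" for a b c
    using act_tris[OF inv_closed[OF assms] that(4)] that act_inv(1)[OF assms] by simp
  ultimately show ?thesis
    unfolding triangulation_aut_def using act_tris[OF assms] by blast
qed

text \<open>An element is determined by its cosets of two types.\<close>

lemma act_faithful:
  assumes "h \<in> carrier G" "h' \<in> carrier G" "\<And>v. v \<in> verts \<Longrightarrow> act h v = act h' v"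
  shows "h = h'"
proof -
  have "vx i h = vx i h'" for i
    using assms(3)[of "vx i \<one>"] assms(1,2) by (auto simp: act_vx verts_def)
  then obtain j k :: int where jk: "h' = h \<otimes> x 0 [^] j" "h' = h \<otimes> x (0 + 1) [^] k"
    using vx_eq_iff[OF assms(1,2)] by metis
  then have "x 0 [^] j = x (0 + 1) [^] k"
    using assms(1) by (metis Units_eq Units_l_cancel int_pow_closed x_closed)
  then have "x 0 [^] j = \<one>" by (rule trivial_meet)
  then show ?thesis using jk(1) assms(1) by simp
qed

text \<open>There are \<open>3 * order G / p\<close> vertices, all of degree \<open>2 * p\<close>, so the Euler characteristic
  is \<open>order G * (3 - p) / p\<close>.\<close>

theorem acts_on_riemann_surface:
  assumes "odd p" "3 < p"
  shows "\<exists>(X :: (real^5) topology) A g.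
           riemann_surface X A \<and> compact_space X \<and> has_genus X g \<and> g \<ge> 2 \<and>
           (\<exists>\<phi>. \<phi> \<in> mon G (Aut X A)) \<and>
           real (order G) = 2 * real p / (real p - 3) * (real g - 1)"
proof -
  obtain P :: "3 \<times> 'g set \<Rightarrow> real ^ 5" where geo: "geometric_triangulation verts tris (2 * p) P"
    using exists_geometric_triangulation[OF oriented_triangulation_axioms] .
  then interpret geometric_triangulation verts tris "2 * p" P .
  let ?X = "top_of_set polyhedron"
  obtain r where r: "p = 2 * r + 3"
  proof -
    obtain k where "p = 2 * k + 1" using assms(1) by (elim oddE)
    then show ?thesis using that[of "k - 1"] assms(2) by simp
  qed
  have "p dvd order G"
    using ord_dvd_group_order[of "x 0"] x_ord by simp
  then obtain m where m: "order G = p * m" by (elim dvdE)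
  have cV: "card verts = 3 * m"
    using card_verts m assms by simp
  have "m > 0" "r > 0" using m order_gt_0_iff_finite finite_G r assms by (auto intro: Nat.gr0I)
  \<comment> \<open>With \<open>order G = p * m\<close> and \<open>p - 3 = 2 * r\<close>, this solves \<open>order G * (p - 3) = 2 * p * (g - 1)\<close>.\<close>
  define g where "g = 1 + m * r"
  have "has_genus ?X g"
    by (rule has_genus_polyhedron[OF geo]) (simp add: cV r g_def algebra_simps)
  moreover have "g \<ge> 2" using \<open>m > 0\<close> \<open>r > 0\<close> by (simp add: g_def Suc_le_eq)
  moreover have "real (order G) = 2 * real p / (real p - 3) * (real g - 1)"
    using \<open>r > 0\<close> by (simp add: m r g_def)
  moreover have "(\<lambda>h. surface_aut (act h)) \<in> mon G (Aut ?X atlas)"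
  proof -
    have "surface_aut (act (h \<otimes> h')) = surface_aut (act h) \<otimes>\<^bsub>Aut ?X atlas\<^esub> surface_aut (act h')"
      if "h \<in> carrier G" "h' \<in> carrier G" for h h'
    proof -
      have "surface_aut (act (h \<otimes> h')) = surface_aut (act h \<circ> act h')"
      proof -
        have "pl_map (act (h \<otimes> h')) = pl_map (act h \<circ> act h')"
          by (rule ext, rule pl_map_cong) (simp add: act_mult[OF that])
        then show ?thesis by (simp add: surface_aut_def)
      qed
      then show ?thesis using surface_aut_mult act_aut that by simp
    qed
    moreover have "inj_on (\<lambda>h. surface_aut (act h)) (carrier G)"
      using surface_aut_eqD act_faithful act_verts by (intro inj_onI) metis
    ultimately show ?thesis
      unfolding mon_def hom_def using surface_aut_Aut act_aut by auto
  qed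
  ultimately show ?thesis
    using riemann_surface_polyhedron compact_space_polyhedron by blast
qed

end

section \<open>Metabelian groups inside a wreath product\<close>

text \<open>A nontrivial power of an element of prime order has that element as a power, by Bezout.\<close>

lemma (in group) prime_power_in_subgroup:
  assumes "subgroup H G" "v \<in> carrier G" "prime (ord v)" "v [^] (k :: int) \<in> H" "v [^] k \<noteq> \<one>"
  shows "v \<in> H"
proof -
  have "\<not> int (ord v) dvd k" using int_pow_eq_id[OF assms(2)] assms(5) by blast
  then have "coprime (int (ord v)) k"
    using assms(3) by (simp add: prime_imp_coprime)
  then obtain a b where "a * int (ord v) + b * k = 1"
    using bezout_int[of "int (ord v)" k] by (metis coprime_imp_gcd_eq_1)
  then have ab: "k * b - 1 = int (ord v) * (- a)" by (simp add: algebra_simps)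
  have "v [^] (1 :: int) = v [^] (k * b)"
    using int_pow_eq[OF assms(2), of 1 "k * b"] ab by simp
  then have "v = (v [^] k) [^] b"
    using assms(2) by (simp add: int_pow_pow)
  moreover have "(v [^] k) [^] b \<in> H"
    using subgroup_int_pow_closed[OF assms(1,4)] .
  ultimately show ?thesis by simp
qed

text \<open>If two of the three cyclic groups of prime order met nontrivially, they would coincide.  Any two
  of the elements \<open>a\<close>, \<open>b\<close> and \<open>inv (a \<otimes> b)\<close> generate the third, so \<open>b\<close> would be a power
  of \<open>a\<close>.\<close>

lemma (in group) triangle_group_of_two_generators:
  assumes fin: "finite (carrier G)" and p: "prime p"
    and ab: "a \<in> carrier G" "b \<in> carrier G" "ord a = p" "ord b = p" "ord (a \<otimes> b) = p"
    and b: "b \<notin> generate G {a}" and gen: "generate G {a, b} = carrier G"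
  shows "triangle_group G p (\<lambda>i. if i = 0 then a else if i = 1 then b else inv (a \<otimes> b))"
proof -
  let ?x = "\<lambda>i :: 3. if i = 0 then a else if i = 1 then b else inv (a \<otimes> b)"
  define c where "c = inv (a \<otimes> b)"
  have c: "c \<in> carrier G" "ord c = p" using ab by (simp_all add: c_def)
  have sub: "subgroup (generate G {u}) G" if "u \<in> carrier G" for u
    using that generate_is_subgroup by simp
  have pow_in: "u [^] (k :: int) \<in> generate G {u}" if "u \<in> carrier G" for u k
    using that generate_pow by blast
  have self: "u \<in> generate G {u}" for u by (simp add: generate.incl)
  have meet: "v \<in> generate G {u}" if "u \<in> carrier G" "v \<in> carrier G" "ord v = p"
      "v [^] (k :: int) = u [^] (j :: int)" "v [^] k \<noteq> \<one>" for u v j k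
    using prime_power_in_subgroup[OF sub[OF that(1)] that(2), of k] that(3-5) p pow_in[OF that(1), of j] by simp
  have cancel: "v \<in> H" "u \<in> H \<longleftrightarrow> v \<in> H"
    if "subgroup H G" "u \<in> H" "c \<in> H" "u = a \<and> v = b \<or> u = b \<and> v = a" for H u v
  proof -
    have "inv c = a \<otimes> b" using ab by (simp add: c_def)
    then have prod: "a \<otimes> b \<in> H" using subgroup.m_inv_closed[OF that(1,3)] by simp
    show "v \<in> H"
    proof (cases "u = a \<and> v = b")
      case True
      then have "inv a \<otimes> (a \<otimes> b) \<in> H"
        using subgroup.m_closed[OF that(1) subgroup.m_inv_closed[OF that(1,2)] prod] by simp
      then show ?thesis using True ab by (simp add: m_assoc[symmetric])
    next
      case False
      then have uv: "u = b" "v = a" using that by auto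
      then have "(a \<otimes> b) \<otimes> inv b \<in> H"
        using subgroup.m_closed[OF that(1) prod subgroup.m_inv_closed[OF that(1,2)]] by simp
      then show ?thesis using uv ab by (simp add: m_assoc)
    qed
    then show "u \<in> H \<longleftrightarrow> v \<in> H" using that by simp
  qed
  have a_notin: "a \<notin> generate G {b}"
  proof
    assume "a \<in> generate G {b}"
    then obtain k :: int where k: "a = b [^] k" using generate_pow[OF ab(2)] by blast
    have "a \<noteq> \<one>" using ab(3) p ord_eq_1[OF ab(1)] by auto
    then show False using meet[OF ab(1,2,4), of k 1] k ab b by (simp add: int_pow_1)
  qed
  have three: "(0::3) + 1 = 1" "(1::3) + 1 = 2" "(2::3) + 1 = 0" "(0::3) + 2 = 2" "(1::3) + 2 = 0" "(2::3) + 2 = 1"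
    "(2::3) \<noteq> 0" "(2::3) \<noteq> 1" "(1::3) \<noteq> 0"
    by simp_all
  show ?thesis
  proof (unfold_locales, goal_cases)
    case 1
    then show ?case by (rule fin)
  next
    case 2
    then show ?case using prime_ge_2_nat[OF p] .
  next
    case (3 i)
    then show ?case using ab by simp
  next
    case (4 i)
    then show ?case using ab by simp
  next
    case (5 i)
    have "a \<otimes> b \<otimes> c = \<one>" using ab by (simp add: c_def)
    moreover have "c \<otimes> a \<otimes> b = \<one>" using ab by (simp add: c_def m_assoc)
    moreover have "b \<otimes> c \<otimes> a = \<one>"
      using ab by (simp add: c_def inv_mult_group m_assoc[symmetric])
    ultimately show ?case
      using exhaust3[of i] by (elim disjE) (simp_all only: three c_def if_True if_False refl not_False_eq_True)
  next
    case (6 i j k)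
    show ?case
    proof (rule ccontr)
      assume ne: "?x i [^] j \<noteq> \<one>"
      consider "i = 0" | "i = 1" | "i = 2" using exhaust3[of i] by blast
      then show False
      proof cases
        case 1
        then have "a [^] j = b [^] k" "a [^] j \<noteq> \<one>" using 6 ne by (simp_all add: three)
        then show False using meet[OF ab(1,2,4), of k j] b by simp
      next
        case 2
        then have "b [^] j = c [^] k" "b [^] j \<noteq> \<one>" using 6 ne by (simp_all add: three c_def)
        then have "c \<in> generate G {b}" using meet[OF ab(2) c, of k j] by simp
        then show False using cancel(1)[OF sub[OF ab(2)] self, of a] a_notin by simp
      next
        case 3
        then have "c [^] j = a [^] k" "c [^] j \<noteq> \<one>" using 6 ne by (simp_all only: three c_def if_True if_False refl not_False_eq_True)
        then have "c \<in> generate G {a}" using meet[OF ab(1) c, of j k] by simp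
        then show False using cancel(1)[OF sub[OF ab(1)] self, of b] b by simp
      qed
    qed
  next
    case 7
    have "range ?x \<subseteq> carrier G" using ab by auto
    moreover have "{a, b} \<subseteq> range ?x"
      using rangeI[of ?x 0] rangeI[of ?x 1] by simp
    ultimately show ?case
      using mono_generate[of "{a, b}" "range ?x"] gen generate_incl[of "range ?x"] by blast
  qed
qed

text \<open>The map \<open>t\<close> stands for a homomorphism to the cyclic group of order \<open>n\<close> with abelian kernel; the
  kernel contains all commutators.\<close>

lemma (in group) metabelianI:
  fixes t :: "'a \<Rightarrow> int"
  assumes n: "n > 0"
    and hom: "\<And>g h. g \<in> carrier G \<Longrightarrow> h \<in> carrier G \<Longrightarrow> t (g \<otimes> h) = (t g + t h) mod n"
    and comm: "\<And>g h. \<lbrakk>g \<in> carrier G; h \<in> carrier G; t g = 0; t h = 0\<rbrakk> \<Longrightarrow> g \<otimes> h = h \<otimes> g"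
  shows "metabelian G"
proof -
  have range: "t g mod n = t g" if "g \<in> carrier G" for g
    using hom[of g \<one>] that by simp (metis mod_mod_trivial)
  have zero: "t g = 0" if "g \<in> carrier G" "(t g + s) mod n = s mod n" for g s
  proof -
    have "n dvd t g" using that(2) by (metis add_diff_cancel_right' mod_eq_dvd_iff)
    then show ?thesis using range[OF that(1)] by (metis dvd_imp_mod_0)
  qed
  have t1: "t \<one> = 0"
    using hom[of \<one> \<one>] range[of \<one>] by (intro zero[of _ "t \<one>"]) simp_all
  let ?N = "{g \<in> carrier G. t g = 0}"
  have N: "subgroup ?N G"
  proof (rule subgroupI)
    fix g assume "g \<in> ?N"
    then have g: "g \<in> carrier G" "t g = 0" by auto
    have "t (inv g) = 0"
      using hom[of "inv g" g] g t1 range[of "inv g"] by simp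
    then show "inv g \<in> ?N" using g by simp
  qed (use t1 hom in auto)
  have "derived G (carrier G) \<subseteq> ?N"
    unfolding derived_def
  proof (rule generate_subgroup_incl[OF _ N], safe)
    fix g h assume gh: "g \<in> carrier G" "h \<in> carrier G"
    let ?c = "g \<otimes> h \<otimes> inv g \<otimes> inv h"
    show "?c \<in> carrier G" using gh by simp
    \<comment> \<open>The two products differ by the commutator and have the same value under \<open>t\<close>.\<close>
    have "?c \<otimes> (h \<otimes> g) = g \<otimes> h" using gh by (simp add: m_assoc inv_solve_left')
    then have "(t ?c + (t h + t g) mod n) mod n = (t g + t h) mod n"
      using hom[of ?c "h \<otimes> g"] hom[of h g] hom[of g h] gh by simp
    then have "(t ?c + (t h + t g)) mod n = (t h + t g) mod n"
      by (simp add: mod_simps add.commute)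
    then show "t ?c = 0" using zero[of ?c] gh by simp
  qed
  then have D: "g \<otimes> h = h \<otimes> g" if "g \<in> derived G (carrier G)" "h \<in> derived G (carrier G)" for g h
    using comm that by blast
  interpret D: group "G\<lparr>carrier := derived G (carrier G)\<rparr>"
    using subgroup_imp_group[OF derived_is_subgroup] by simp
  have "comm_group (G\<lparr>carrier := derived G (carrier G)\<rparr>)"
    by (rule D.group_comm_groupI) (simp add: D)
  then show ?thesis unfolding metabelian_def using is_group by blast
qed

text \<open>The wreath product of the cyclic groups of orders \<open>m\<close> and \<open>p\<close>: functions on the integers
  modulo \<open>p\<close> with values in the integers modulo \<open>m\<close>, extended by the cyclic shifts.\<close>

definition wreath :: "int \<Rightarrow> int \<Rightarrow> (int \<times> (int \<Rightarrow> int)) monoid" where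
  "wreath p m = \<lparr>carrier = {0..<p} \<times> ({0..<p} \<rightarrow>\<^sub>E {0..<m}),
     mult = (\<lambda>(i, f) (j, g). ((i + j) mod p, \<lambda>k\<in>{0..<p}. (f k + g ((k + i) mod p)) mod m)),
     one = (0, \<lambda>k\<in>{0..<p}. 0)\<rparr>"

lemma wreath_carrier: "carrier (wreath p m) = {0..<p} \<times> ({0..<p} \<rightarrow>\<^sub>E {0..<m})"
  and wreath_mult: "(i, f) \<otimes>\<^bsub>wreath p m\<^esub> (j, g) =
    ((i + j) mod p, \<lambda>k\<in>{0..<p}. (f k + g ((k + i) mod p)) mod m)"
  and wreath_one: "\<one>\<^bsub>wreath p m\<^esub> = (0, \<lambda>k\<in>{0..<p}. 0)"
  by (simp_all add: wreath_def)

lemma wreath_fst_mult: "fst (g \<otimes>\<^bsub>wreath p m\<^esub> h) = (fst g + fst h) mod p"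
  by (cases g; cases h) (simp add: wreath_mult)

lemma wreath_card: "p > 0 \<Longrightarrow> m > 0 \<Longrightarrow> order (wreath p m) = nat p * nat m ^ nat p"
  and wreath_finite: "finite (carrier (wreath p m))"
  by (auto simp: order_def wreath_carrier card_cartesian_product card_PiE intro!: finite_cartesian_product finite_PiE)

lemma wreath_group:
  assumes "p > 0" "m > 0" shows "group (wreath p m)"
proof (rule groupI)
  show "\<one>\<^bsub>wreath p m\<^esub> \<in> carrier (wreath p m)"
    using assms by (auto simp: wreath_carrier wreath_one)
  fix a assume a: "a \<in> carrier (wreath p m)"
  obtain i f where af: "a = (i, f)" by (cases a)
  have f: "0 \<le> i" "i < p" "f \<in> extensional {0..<p}" "\<And>k. 0 \<le> k \<Longrightarrow> k < p \<Longrightarrow> 0 \<le> f k \<and> f k < m"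
    using a by (auto simp: wreath_carrier af PiE_def Pi_iff)
  show "\<one>\<^bsub>wreath p m\<^esub> \<otimes>\<^bsub>wreath p m\<^esub> a = a"
    using f by (auto simp: wreath_one wreath_mult af intro!: extensionalityI[of _ "{0..<p}"])
  have "((- i) mod p, \<lambda>k\<in>{0..<p}. (- f ((k - i) mod p)) mod m) \<otimes>\<^bsub>wreath p m\<^esub> a = \<one>\<^bsub>wreath p m\<^esub>"
  proof -
    have "(k + (- i) mod p) mod p = (k - i) mod p" for k
      by (metis mod_add_right_eq uminus_add_conv_diff add.commute)
    then show ?thesis by (auto simp: wreath_one wreath_mult af mod_simps intro!: restrict_ext)
  qed
  moreover have "((- i) mod p, \<lambda>k\<in>{0..<p}. (- f ((k - i) mod p)) mod m) \<in> carrier (wreath p m)"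
    using assms by (auto simp: wreath_carrier)
  ultimately show "\<exists>b\<in>carrier (wreath p m). b \<otimes>\<^bsub>wreath p m\<^esub> a = \<one>\<^bsub>wreath p m\<^esub>" by blast
  fix b assume "b \<in> carrier (wreath p m)"
  obtain j g where bg: "b = (j, g)" by (cases b)
  show "a \<otimes>\<^bsub>wreath p m\<^esub> b \<in> carrier (wreath p m)"
    using assms by (auto simp: wreath_carrier af bg wreath_mult)
  fix c :: "int \<times> (int \<Rightarrow> int)"
  obtain l h where ch: "c = (l, h)" by (cases c)
  have "(k + (i + j) mod p) mod p = ((k + i) mod p + j) mod p" for k
    by (simp add: mod_simps add.assoc)
  then show "a \<otimes>\<^bsub>wreath p m\<^esub> b \<otimes>\<^bsub>wreath p m\<^esub> c = a \<otimes>\<^bsub>wreath p m\<^esub> (b \<otimes>\<^bsub>wreath p m\<^esub> c)"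
    using assms by (auto simp: af bg ch wreath_mult mod_simps add.assoc intro!: restrict_ext)
qed

lemma wreath_pow:
  assumes "p > 0" "m > 0" "(i, f) \<in> carrier (wreath p m)"
  shows "(i, f) [^]\<^bsub>wreath p m\<^esub> (n :: nat) =
    ((int n * i) mod p, \<lambda>k\<in>{0..<p}. (\<Sum>l<n. f ((k + int l * i) mod p)) mod m)"
proof (induction n)
  case 0
  then show ?case by (auto simp: wreath_one)
next
  case (Suc n)
  have "(k + (int n * i) mod p) mod p = (k + int n * i) mod p" for k
    by (simp add: mod_simps)
  then show ?case
    using assms by (auto simp: Suc wreath_mult mod_simps algebra_simps intro!: restrict_ext)
qed

text \<open>The \<open>p\<close>-th power of a proper shift sums the values of \<open>f\<close> over an orbit, that is, over all of
  the integers modulo \<open>p\<close>.\<close>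

lemma wreath_ord:
  assumes p: "prime p" and m: "m > 0" and el: "(i, f) \<in> carrier (wreath (int p) m)"
    and i: "\<not> int p dvd i" and sum: "(\<Sum>k\<in>{0..<int p}. f k) mod m = 0"
  shows "group.ord (wreath (int p) m) (i, f) = p"
proof -
  have p0: "int p > 0" using p prime_gt_0_nat by simp
  interpret group "wreath (int p) m" by (rule wreath_group[OF p0 m])
  let ?W = "wreath (int p) m"
  have one: "(i, f) [^]\<^bsub>?W\<^esub> p = \<one>\<^bsub>?W\<^esub>"
  proof -
    have "(\<Sum>l<p. f ((k + int l * i) mod int p)) = (\<Sum>k\<in>{0..<int p}. f k)" for k
    proof (rule sum.reindex_bij_betw)
      have inj: "inj_on (\<lambda>l. (k + int l * i) mod int p) {..<p}"
      proof (rule inj_onI)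
        fix a b assume ab: "a \<in> {..<p}" "b \<in> {..<p}" "(k + int a * i) mod int p = (k + int b * i) mod int p"
        then have "int p dvd (int a - int b) * i"
          by (simp add: mod_eq_dvd_iff left_diff_distrib)
        then have "int p dvd int a - int b"
          using i p by (simp add: prime_dvd_mult_iff)
        then have "int a mod int p = int b mod int p" by (simp add: mod_eq_dvd_iff)
        then show "a = b" using ab by simp
      qed
      moreover have "(\<lambda>l. (k + int l * i) mod int p) ` {..<p} \<subseteq> {0..<int p}"
        using p0 by auto
      ultimately have "(\<lambda>l. (k + int l * i) mod int p) ` {..<p} = {0..<int p}"
        by (intro card_subset_eq) (simp_all add: card_image)
      then show "bij_betw (\<lambda>l. (k + int l * i) mod int p) {..<p} {0..<int p}"
        using inj by (simp add: bij_betw_def)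
    qed
    then show ?thesis using sum wreath_pow[OF p0 m el] by (simp add: wreath_one)
  qed
  have "(i, f) [^]\<^bsub>?W\<^esub> n = \<one>\<^bsub>?W\<^esub> \<longleftrightarrow> p dvd n" for n
  proof
    assume "(i, f) [^]\<^bsub>?W\<^esub> n = \<one>\<^bsub>?W\<^esub>"
    then have "int p dvd int n * i"
      using wreath_pow[OF p0 m el] by (simp add: wreath_one mod_eq_0_iff_dvd)
    then show "p dvd n" using i p by (simp add: prime_dvd_mult_iff)
  next
    assume "p dvd n"
    then obtain r where "n = p * r" by (elim dvdE)
    then show "(i, f) [^]\<^bsub>?W\<^esub> n = \<one>\<^bsub>?W\<^esub>"
      using one el by (simp add: nat_pow_pow[symmetric])
  qed
  then show ?thesis using ord_unique[OF el] by blast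
qed

text \<open>Modulo \<open>m\<close>, the function \<open>e\<close> takes the values 1 and \<open>-1\<close> at 0 and 1, and vanishes elsewhere.  Since its sum is
  0 modulo \<open>m\<close>, the elements \<open>a = (1, 0)\<close>, \<open>b = (1, e)\<close> and their product have order \<open>p\<close>.  The
  subgroup that they generate contains \<open>b \<otimes> inv a = (0, e)\<close>, of order \<open>q ^ n\<close>.  The last clause of the
  statement says that the first component is a homomorphism with abelian kernel.\<close>

lemma exists_large_group:
  fixes p q :: nat
  assumes p: "prime p" "3 < p" and q: "prime q" "p < q" and n: "n \<ge> 1"
  shows "\<exists>(G :: (int \<times> (int \<Rightarrow> int)) monoid) k x. group G \<and> finite (carrier G) \<and> order G = p * q ^ k \<and> n \<le> k
    \<and> triangle_group G p x \<and> (\<forall>g\<in>carrier G. \<forall>h\<in>carrier G. fst (g \<otimes>\<^bsub>G\<^esub> h) = (fst g + fst h) mod int p \<and>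
        (fst g = 0 \<and> fst h = 0 \<longrightarrow> g \<otimes>\<^bsub>G\<^esub> h = h \<otimes>\<^bsub>G\<^esub> g))"
proof -
  define m :: int where "m = int q ^ n"
  have q1: "q > 1" using q(1) prime_gt_1_nat by blast
  have m1: "m > 1" unfolding m_def using q1 n by (simp add: one_less_power)
  then have m: "m > 0" by simp
  have p0: "int p > 0" using p by simp
  let ?W = "wreath (int p) m"
  interpret W: group ?W by (rule wreath_group[OF p0 m])
  define e :: "int \<Rightarrow> int" where "e = (\<lambda>k\<in>{0..<int p}. if k = 0 then 1 else if k = 1 then m - 1 else 0)"
  define a where "a = (1 :: int, \<lambda>k\<in>{0..<int p}. 0 :: int)"
  define b where "b = (1 :: int, e)"
  define w where "w = (0 :: int, e)"
  have e_car: "e \<in> {0..<int p} \<rightarrow>\<^sub>E {0..<m}" using m1 by (auto simp: e_def)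
  have a: "a \<in> carrier ?W" and b: "b \<in> carrier ?W" and w: "w \<in> carrier ?W"
    using p m1 e_car by (auto simp: a_def b_def w_def wreath_carrier)
  have e_sum: "(\<Sum>k\<in>{0..<int p}. e k) = m"
  proof -
    have "(\<Sum>k\<in>{0..<int p}. e k) = (\<Sum>k\<in>{0, 1}. e k)"
      using p by (intro sum.mono_neutral_right) (auto simp: e_def)
    then show ?thesis using p by (simp add: e_def)
  qed
  have not_dvd: "\<not> int p dvd 1" "\<not> int p dvd 2" using p by (auto dest: zdvd_imp_le)
  have orda: "W.ord a = p"
    unfolding a_def using wreath_ord[OF p(1) m a[unfolded a_def] not_dvd(1)] by simp
  have ordb: "W.ord b = p"
    unfolding b_def using wreath_ord[OF p(1) m b[unfolded b_def] not_dvd(1)] e_sum by simp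
  have ordab: "W.ord (a \<otimes>\<^bsub>?W\<^esub> b) = p"
  proof -
    have "a \<otimes>\<^bsub>?W\<^esub> b = (2, \<lambda>k\<in>{0..<int p}. e ((k + 1) mod int p))"
      using p e_car by (auto simp: a_def b_def wreath_mult PiE_def Pi_iff intro!: restrict_ext)
    moreover have "(\<Sum>k\<in>{0..<int p}. e ((k + 1) mod int p)) = (\<Sum>k\<in>{0..<int p}. e k)"
    proof (rule sum.reindex_bij_witness[of _ "\<lambda>k. (k - 1) mod int p" "\<lambda>k. (k + 1) mod int p"])
    qed (use p in \<open>auto simp: mod_simps\<close>)
    ultimately show ?thesis
      using wreath_ord[OF p(1) m _ not_dvd(2), of "\<lambda>k\<in>{0..<int p}. e ((k + 1) mod int p)"] e_sum
        W.m_closed[OF a b] by simp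
  qed
  define K where "K = generate ?W {a, b}"
  have K: "subgroup K ?W" unfolding K_def using a b by (intro W.generate_is_subgroup) auto
  have abK: "a \<in> K" "b \<in> K" unfolding K_def by (auto intro: generate.incl)
  let ?G = "?W\<lparr>carrier := K\<rparr>"
  interpret G: group ?G by (rule W.subgroup_imp_group[OF K])
  have finK: "finite K" using K wreath_finite subgroup.subset finite_subset by metis
  have ordG: "G.ord u = W.ord u" if "u \<in> K" for u
    using that K subgroup.mem_carrier[OF K]
    by (subst G.ord_unique) (simp_all add: W.nat_pow_consistent[symmetric] W.pow_eq_id)
  have tri: "triangle_group ?G p (\<lambda>i. if i = 0 then a else if i = 1 then b else inv\<^bsub>?G\<^esub> (a \<otimes>\<^bsub>?G\<^esub> b))"
  proof (rule G.triangle_group_of_two_generators)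
    show "finite (carrier ?G)" using finK by simp
    show "prime p" by fact
    show "a \<in> carrier ?G" "b \<in> carrier ?G" using abK by simp_all
    show "G.ord a = p" "G.ord b = p" using ordG abK orda ordb by simp_all
    show "G.ord (a \<otimes>\<^bsub>?G\<^esub> b) = p"
      using ordG[of "a \<otimes>\<^bsub>?W\<^esub> b"] abK ordab subgroup.m_closed[OF K] by simp
    show "generate ?G {a, b} = carrier ?G"
      using W.generate_consistent[of "{a, b}" K] K abK by (simp add: K_def)
    show "b \<notin> generate ?G {a}"
    proof
      assume "b \<in> generate ?G {a}"
      then obtain r :: nat where "b = a [^]\<^bsub>?G\<^esub> r"
        using G.generate_pow_on_finite_carrier[of a] finK abK by auto
      then have "b = a [^]\<^bsub>?W\<^esub> r" using W.nat_pow_consistent by metis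
      then have "snd b 0 = 0"
        unfolding a_def using wreath_pow[OF p0 m a[unfolded a_def]] p by simp
      then show False using p by (simp add: b_def e_def)
    qed
  qed
  have wK: "w \<in> K"
  proof -
    have "w \<otimes>\<^bsub>?W\<^esub> a = b"
    proof -
      have "(\<lambda>k\<in>{0..<int p}. e k mod m) = e"
        using e_car by (intro extensionalityI[of _ "{0..<int p}"]) (auto simp: PiE_def Pi_iff)
      then show ?thesis using p by (simp add: w_def a_def b_def wreath_mult cong: restrict_cong)
    qed
    then have "w = b \<otimes>\<^bsub>?W\<^esub> inv\<^bsub>?W\<^esub> a" using a b w by (metis W.inv_solve_right)
    then show ?thesis using K abK by (simp add: subgroup.m_closed subgroup.m_inv_closed)
  qed
  have ordw: "W.ord w = q ^ n"
  proof -
    have "w [^]\<^bsub>?W\<^esub> r = \<one>\<^bsub>?W\<^esub> \<longleftrightarrow> q ^ n dvd r" for r :: nat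
    proof
      assume "w [^]\<^bsub>?W\<^esub> r = \<one>\<^bsub>?W\<^esub>"
      then have "snd (w [^]\<^bsub>?W\<^esub> r) 0 = 0" using p by (simp add: wreath_one)
      then have "int r mod m = 0"
        unfolding w_def using wreath_pow[OF p0 m w[unfolded w_def]] p by (simp add: e_def)
      then have "int (q ^ n) dvd int r" unfolding m_def by (simp add: mod_eq_0_iff_dvd)
      then show "q ^ n dvd r" by (simp only: int_dvd_int_iff)
    next
      assume "q ^ n dvd r"
      then have "m dvd int r" unfolding m_def by (metis int_dvd_int_iff of_nat_power)
      then have "int r * c mod m = 0" for c by simp
      then show "w [^]\<^bsub>?W\<^esub> r = \<one>\<^bsub>?W\<^esub>"
        unfolding w_def using wreath_pow[OF p0 m w[unfolded w_def]] by (auto simp: wreath_one intro!: restrict_ext)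
    qed
    then show ?thesis using W.ord_unique[OF w] by blast
  qed
  have "order ?G dvd order ?W"
  proof -
    have "card (rcosets\<^bsub>?W\<^esub> K) * order ?G = order ?W"
      using W.lagrange[OF K] by (simp add: order_def)
    then show ?thesis by (metis dvd_triv_right)
  qed
  then have o1: "order ?G dvd p * q ^ (n * p)"
    using wreath_card[OF p0 m] by (simp add: m_def nat_power_eq power_mult)
  have "p dvd order ?G" using G.ord_dvd_group_order[of a] ordG abK orda by simp
  then obtain E where E: "order ?G = p * E" by (elim dvdE)
  then have "E dvd q ^ (n * p)" using o1 p by simp
  then obtain k where k: "E = q ^ k" using q(1) by (auto simp: divides_primepow_nat)
  have "q ^ n dvd p * q ^ k" using G.ord_dvd_group_order[of w] ordG wK ordw E k by simp
  moreover have "coprime (q ^ n) p"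
    using p q by (simp add: primes_coprime)
  ultimately have "q ^ n dvd q ^ k" using coprime_dvd_mult_right_iff by blast
  then have "n \<le> k" using q1 by (simp add: dvd_power_iff_le)
  have comm: "g \<otimes>\<^bsub>?W\<^esub> h = h \<otimes>\<^bsub>?W\<^esub> g" if "fst g = 0" "fst h = 0" for g h
    using that by (cases g; cases h) (auto simp: wreath_mult add.commute intro!: restrict_ext)
  have "group ?G \<and> finite (carrier ?G) \<and> order ?G = p * q ^ k \<and> n \<le> k \<and>
      triangle_group ?G p (\<lambda>i. if i = 0 then a else if i = 1 then b else inv\<^bsub>?G\<^esub> (a \<otimes>\<^bsub>?G\<^esub> b)) \<and>
      (\<forall>g\<in>carrier ?G. \<forall>h\<in>carrier ?G. fst (g \<otimes>\<^bsub>?G\<^esub> h) = (fst g + fst h) mod int p \<and>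
        (fst g = 0 \<and> fst h = 0 \<longrightarrow> g \<otimes>\<^bsub>?G\<^esub> h = h \<otimes>\<^bsub>?G\<^esub> g))"
    using G.is_group finK E k \<open>n \<le> k\<close> tri comm wreath_fst_mult by simp
  then show ?thesis by blast
qed

section \<open>The infinite family\<close>

definition realizable :: "nat \<Rightarrow> nat \<Rightarrow> nat monoid \<Rightarrow> bool" where
  "realizable p q G \<longleftrightarrow> pq_group p q G \<and> metabelian G \<and>
        (\<exists>(X :: (real^5) topology) A g.
           riemann_surface X A \<and> compact_space X \<and> has_genus X g \<and> g \<ge> 2 \<and>
           (\<exists>\<phi>. \<phi> \<in> mon G (Aut X A)) \<and>
           real (order G) = 2 * real p / (real p - 3) * (real g - 1))"

text \<open>The group is copied to the natural numbers along an injection of its carrier.\<close>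

lemma exists_large_realizable:
  assumes "prime p" "prime q" "3 < p" "p < q" "n \<ge> 1"
  shows "\<exists>G. realizable p q G \<and> n < order G"
proof -
  obtain G :: "(int \<times> (int \<Rightarrow> int)) monoid" and k x where G: "group G" "finite (carrier G)"
      "order G = p * q ^ k" "n \<le> k" "triangle_group G p x"
      and fst_mult: "\<And>g h. g \<in> carrier G \<Longrightarrow> h \<in> carrier G \<Longrightarrow> fst (g \<otimes>\<^bsub>G\<^esub> h) = (fst g + fst h) mod int p"
      and comm: "\<And>g h. g \<in> carrier G \<Longrightarrow> h \<in> carrier G \<Longrightarrow> fst g = 0 \<Longrightarrow> fst h = 0 \<Longrightarrow> g \<otimes>\<^bsub>G\<^esub> h = h \<otimes>\<^bsub>G\<^esub> g"
    using exists_large_group[OF assms(1,3,2,4,5)] by metis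
  interpret G: triangle_group G p x by fact
  obtain e :: "_ \<Rightarrow> nat" where e: "inj_on e (carrier G)"
    using finite_imp_inj_to_nat_seg[OF G(2)] by metis
  define H where "H = image_group e G"
  have iso: "e \<in> iso G H" unfolding H_def by (rule inj_imp_image_group_iso[OF e])
  interpret H: group H unfolding H_def by (rule G.inj_imp_image_group_is_group[OF e])
  define d where "d = inv_into (carrier G) e"
  have d: "d \<in> iso H G" unfolding d_def by (rule G.iso_set_sym[OF iso])
  have d_car: "d g \<in> carrier G" if "g \<in> carrier H" for g
    using d that by (auto simp: iso_def hom_def)
  have d_mult: "d (g \<otimes>\<^bsub>H\<^esub> h) = d g \<otimes>\<^bsub>G\<^esub> d h" if "g \<in> carrier H" "h \<in> carrier H" for g h
    using d that by (auto simp: iso_def hom_def)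
  have d_inj: "inj_on d (carrier H)" using d by (auto simp: iso_def bij_betw_def)
  have card: "order H = order G"
    using d bij_betw_same_card unfolding order_def iso_def by blast
  have "finite (carrier H)"
    using d G(2) bij_betw_finite unfolding iso_def by blast
  moreover have "1 \<le> k" using G(4) assms(5) by simp
  ultimately have "pq_group p q H"
    unfolding pq_group_def using card G(3) H.is_group
    by (intro conjI exI[of _ 1] exI[of _ k]) auto
  moreover have "metabelian H"
  proof (rule H.metabelianI[where t = "\<lambda>g. fst (d g)"])
    show "int p > 0" using assms(3) by simp
    show "fst (d (g \<otimes>\<^bsub>H\<^esub> h)) = (fst (d g) + fst (d h)) mod int p" if "g \<in> carrier H" "h \<in> carrier H" for g h
      using that d_mult d_car fst_mult by simp
    show "g \<otimes>\<^bsub>H\<^esub> h = h \<otimes>\<^bsub>H\<^esub> g" if "g \<in> carrier H" "h \<in> carrier H" "fst (d g) = 0" "fst (d h) = 0" for g h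
    proof -
      have "d (g \<otimes>\<^bsub>H\<^esub> h) = d (h \<otimes>\<^bsub>H\<^esub> g)"
        using that d_mult d_car comm by simp
      then show ?thesis using d_inj that by (simp add: inj_on_eq_iff)
    qed
  qed
  moreover have "odd p" using assms by (intro prime_odd_nat) auto
  then obtain X :: "(real^5) topology" and A g \<phi> where X: "riemann_surface X A" "compact_space X" "has_genus X g"
      "g \<ge> 2" "\<phi> \<in> mon G (Aut X A)" "real (order G) = 2 * real p / (real p - 3) * (real g - 1)"
    using G.acts_on_riemann_surface assms(3) by metis
  have "\<phi> \<circ> d \<in> mon H (Aut X A)"
  proof -
    have "\<phi> \<circ> d \<in> hom H (Aut X A)"
      using hom_compose[of d H G \<phi> "Aut X A"] d X(5) by (simp add: iso_def mon_def)
    moreover have "inj_on (\<phi> \<circ> d) (carrier H)"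
      using d_inj X(5) d by (intro comp_inj_on) (auto simp: mon_def iso_def bij_betw_def)
    ultimately show ?thesis by (simp add: mon_def)
  qed
  ultimately have "realizable p q H"
    unfolding realizable_def using X card by metis
  moreover have "n < order H"
  proof -
    have "n \<le> k" by fact
    also have "k < q ^ k" using prime_gt_1_nat[OF assms(2)] by (simp add: power_gt_expt)
    also have "\<dots> \<le> p * q ^ k" using assms(3) by simp
    finally show ?thesis using card G(3) by simp
  qed
  ultimately show ?thesis by blast
qed

text \<open>The orders of the groups are unbounded, and choosing one group for each order makes the members of
  the family pairwise non-isomorphic.\<close>

theorem theorem6p3:
  fixes p q :: nat
  assumes "prime p" and "prime q" and "3 < p" and "p < q"
  shows "\<exists>\<G> :: nat monoid set. infinite \<G> \<and>
     (\<forall>G\<in>\<G>. \<forall>H\<in>\<G>. G \<noteq> H \<longrightarrow> \<not> G \<cong> H) \<and>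
     (\<forall>G\<in>\<G>. pq_group p q G \<and> metabelian G \<and>
        (\<exists>(X :: (real^5) topology) A g.
           riemann_surface X A \<and> compact_space X \<and> has_genus X g \<and> g \<ge> 2 \<and>
           (\<exists>\<phi>. \<phi> \<in> mon G (Aut X A)) \<and>
           real (order G) = 2 * real p / (real p - 3) * (real g - 1)))"
proof -
  define N where "N = order ` {G. realizable p q G}"
  have "infinite N"
    unfolding infinite_nat_iff_unbounded
  proof
    fix n
    obtain G where "realizable p q G" "Suc n < order G"
      using exists_large_realizable[OF assms, of "Suc n"] by auto
    then show "\<exists>k>n. k \<in> N" unfolding N_def by (intro exI[of _ "order G"]) auto
  qed
  define pick where "pick k = (SOME G. realizable p q G \<and> order G = k)" for k
  have pick: "realizable p q (pick k)" "order (pick k) = k" if "k \<in> N" for k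
  proof -
    have "\<exists>G. realizable p q G \<and> order G = k" using that unfolding N_def by blast
    from someI_ex[OF this] show "realizable p q (pick k)" "order (pick k) = k"
      unfolding pick_def by auto
  qed
  have "inj_on pick N" using pick(2) by (metis inj_onI)
  then have "infinite (pick ` N)" using \<open>infinite N\<close> finite_imageD by blast
  moreover have "\<not> G \<cong> H" if "G \<in> pick ` N" "H \<in> pick ` N" "G \<noteq> H" for G H
  proof
    assume "G \<cong> H"
    then have "order G = order H" unfolding order_def by (rule iso_same_card)
    then show False using that pick(2) by auto
  qed
  moreover have "realizable p q G" if "G \<in> pick ` N" for G using that pick(1) by blast
  ultimately show ?thesis
    unfolding realizable_def by (intro exI[of _ "pick ` N"]) blast
qed

end
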